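(* Let $h:\mathbb{R}\to\mathbb{R}$ and $f:\mathbb{R}^2\to\mathbb{R}$ be continuous with $f$ continuously differentiable with respect to its second component, let $h_1,h_2\in\mathbb{R}$, and let $\eta_1,\eta_2:C[0,\pi]\to\mathbb{R}$ be (possibly nonlinear) functionals that are continuously differentiable relative to the supremum norm. Suppose $\lambda=n^2$ for some $n\in\mathbb{N}=\{1,2,3,\dots\}$, and that $\bar u$ is a particular solution of the linear nonhomogeneous problem $$v''(x)+\lambda v(x)=h(x),\quad x\in(0,\pi),\qquad v(0)=h_1,\quad v(\pi)=h_2.$$ If $$n\big[\eta_1(\bar u)+(-1)^{n+1}\eta_2(\bar u)\big]=\int_0^{\pi} f(s,\bar u(s))\sin(ns)\,ds$$ and $$n\big[\eta_1'(\bar u)(\sin(n\,\cdot))+(-1)^{n+1}\eta_2'(\bar u)(\sin(n\,\cdot))\big]\neq\int_0^{\pi} f_2(s,\bar u(s))\sin^2(ns)\,ds,$$ then there exists $\delta>0$ such that for every $\varepsilon$ with $|\varepsilon|<\delta$ the boundary value problem $$v''(x)+\lambda v(x)=h(x)+\varepsilon f(x,v(x)),\quad x\in(0,\pi),$$ $$v(0)=h_1+\varepsilon\eta_1(v),\qquad v(\pi)=h_2+\varepsilon\eta_2(v)$$ has at least one solution.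
   Context: $C[0,\pi]$ is the Banach space of real-valued continuous functions on $[0,\pi]$ with the supremum norm $\|\cdot\|_\infty$. $f_2$ denotes the partial derivative of $f(x,v)$ with respect to its second variable; "continuously differentiable with respect to its second component" means that $f_2$ exists and is continuous on $\mathbb{R}^2$. $\eta_i'(\bar u)$ is the Fréchet derivative of $\eta_i$ at $\bar u$, a bounded linear functional on $C[0,\pi]$, and $\sin(n\,\cdot)$ is the function $s\mapsto\sin(ns)$. A solution of either problem is a function $v\in H^2=\{v\in L^2[0,\pi]: v' \text{ absolutely continuous},\ v''\in L^2[0,\pi]\}$ satisfying the equation and the boundary conditions; since $h$ and $f$ are continuous, such a $v$ belongs to $C^2[0,\pi]$. *)

theory Defs
  imports "HOL-Analysis.Analysis"
begin

section \<open>The Banach space \<open>C[0,\<pi>]\<close>\<close>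

text \<open>
  The interval \<open>[0,\<pi>]\<close> is turned into a compact topological space of its own, so that the library
  type \<^typ>\<open>'a \<Rightarrow>\<^sub>C real\<close> of bounded continuous functions, with its supremum norm and its Banach
  space structure, gives \<open>C[0,\<pi>]\<close>, and Frechet derivatives of functionals on \<open>C[0,\<pi>]\<close> are the
  library's.
\<close>

typedef interval_0_pi = "{0..pi} :: real set"
  morphisms point_of Abs_interval_0_pi
  by (auto intro: exI[of _ 0])

instantiation interval_0_pi :: topological_space
begin

definition open_interval_0_pi :: "interval_0_pi set \<Rightarrow> bool"
  where "open_interval_0_pi U \<longleftrightarrow> (\<exists>V. open V \<and> U = point_of -` V)"

instance
proof
  show "open (UNIV :: interval_0_pi set)"
    unfolding open_interval_0_pi_def by (intro exI[of _ UNIV]) auto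
next
  fix S T :: "interval_0_pi set"
  assume "open S" "open T"
  then show "open (S \<inter> T)"
    unfolding open_interval_0_pi_def by (metis open_Int vimage_Int)
next
  fix K :: "interval_0_pi set set"
  assume "\<forall>S\<in>K. open S"
  then obtain V where V: "\<And>S. S \<in> K \<Longrightarrow> open (V S) \<and> S = point_of -` V S"
    unfolding open_interval_0_pi_def by metis
  then have "\<Union>K = point_of -` (\<Union>S\<in>K. V S)" "open (\<Union>S\<in>K. V S)"
    by auto
  then show "open (\<Union>K)"
    unfolding open_interval_0_pi_def by blast
qed

end

type_synonym C_0_pi = "interval_0_pi \<Rightarrow>\<^sub>C real"

text \<open>Only the values of the argument on \<open>[0,\<pi>]\<close> matter; it has to be continuous there.\<close>

definition to_C :: "(real \<Rightarrow> real) \<Rightarrow> C_0_pi"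
  where "to_C v = Bcontfun (\<lambda>s. v (point_of s))"

lemma continuous_on_point_of: "continuous_on UNIV point_of"
  unfolding continuous_on_open_vimage[OF open_UNIV] by (auto simp: open_interval_0_pi_def)

lemma range_point_of: "range point_of = {0..pi}"
  using type_definition.Rep_range[OF type_definition_interval_0_pi] .

lemma compact_UNIV_interval_0_pi: "compact (UNIV :: interval_0_pi set)"
proof (rule compactI)
  fix C :: "interval_0_pi set set"
  assume C: "\<forall>t\<in>C. open t" "UNIV \<subseteq> \<Union>C"
  then obtain V where V: "\<And>S. S \<in> C \<Longrightarrow> open (V S) \<and> S = point_of -` V S"
    unfolding open_interval_0_pi_def by metis
  have "{0..pi} \<subseteq> (\<Union>S\<in>C. V S)"
    using C(2) V unfolding range_point_of[symmetric] by fastforce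
  then obtain D where D: "D \<subseteq> C" "finite D" "{0..pi} \<subseteq> (\<Union>S\<in>D. V S)"
    using compactE_image[OF compact_Icc, of C V 0 pi] V by blast
  have "UNIV \<subseteq> \<Union>D"
  proof
    fix s :: interval_0_pi
    have "point_of s \<in> {0..pi}" by (rule point_of)
    then obtain S where "S \<in> D" "point_of s \<in> V S" using D by blast
    then show "s \<in> \<Union>D" using V D(1) by (metis UnionI subsetD vimageI)
  qed
  with D show "\<exists>C'\<subseteq>C. finite C' \<and> UNIV \<subseteq> \<Union>C'" by blast
qed

lemma to_C_apply:
  assumes "continuous_on {0..pi} v"
  shows "apply_bcontfun (to_C v) s = v (point_of s)"
proof -
  have "continuous_on UNIV (\<lambda>s. v (point_of s))"
    by (rule continuous_on_compose2[OF assms continuous_on_point_of]) (simp add: range_point_of)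
  moreover have "bounded (range (\<lambda>s. v (point_of s)))"
    using compact_imp_bounded[OF compact_continuous_image[OF assms compact_Icc]]
    by (simp add: range_point_of[symmetric] image_image)
  ultimately show ?thesis
    by (simp add: to_C_def Bcontfun_inverse bcontfun_def)
qed

lemma to_C_surj: "\<exists>v. continuous_on {0..pi} v \<and> to_C v = u"
proof -
  let ?v = "\<lambda>x. apply_bcontfun u (Abs_interval_0_pi x)"
  have "continuous_on {0..pi} Abs_interval_0_pi"
    unfolding continuous_on_open_invariant open_interval_0_pi_def
  proof (intro allI impI, elim exE conjE)
    fix B V assume "open V" "B = point_of -` V"
    then show "\<exists>A. open A \<and> A \<inter> {0..pi} = Abs_interval_0_pi -` B \<inter> {0..pi}"
      by (intro exI[of _ V]) (auto simp: Abs_interval_0_pi_inverse)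
  qed
  then have v: "continuous_on {0..pi} ?v"
    by (rule continuous_on_compose2[OF continuous_on_apply_bcontfun[of UNIV]]) simp
  moreover have "to_C ?v = u"
    by (rule bcontfun_eqI) (simp add: to_C_apply[OF v] point_of_inverse)
  ultimately show ?thesis by blast
qed

lemma norm_to_C:
  assumes "continuous_on {0..pi} v"
  shows "norm (to_C v) = (SUP x\<in>{0..pi}. \<bar>v x\<bar>)"
  by (simp add: norm_conv_dist dist_bcontfun.rep_eq to_C_apply[OF assms]
      const_bcontfun.rep_eq zero_bcontfun.rep_eq range_point_of[symmetric] image_image)

section \<open>Solutions in \<open>H\<^sup>2\<close>\<close>

text \<open>\<^term>\<open>d division_of t\<close> says that \<open>d\<close> is a finite set of non-overlapping nonempty compact
  intervals with union \<open>t\<close>.\<close>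

definition abs_continuous_on :: "real \<Rightarrow> real \<Rightarrow> (real \<Rightarrow> real) \<Rightarrow> bool"
  where "abs_continuous_on a b f \<longleftrightarrow>
    (\<forall>\<epsilon>>0. \<exists>\<delta>>0. \<forall>d t. d division_of t \<and> t \<subseteq> {a..b} \<and> (\<Sum>K\<in>d. Sup K - Inf K) < \<delta>
       \<longrightarrow> (\<Sum>K\<in>d. \<bar>f (Sup K) - f (Inf K)\<bar>) < \<epsilon>)"

definition square_integrable_0_pi :: "(real \<Rightarrow> real) \<Rightarrow> bool"
  where "square_integrable_0_pi g \<longleftrightarrow>
    set_borel_measurable lebesgue {0..pi} g \<and> set_integrable lebesgue {0..pi} (\<lambda>x. (g x)\<^sup>2)"

text \<open>\<open>v \<in> H\<^sup>2\<close> with first and second derivatives \<open>v1\<close> and \<open>v2\<close>. As \<open>v1\<close> is only absolutely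
  continuous, \<open>v2\<close> is its derivative almost everywhere and is determined up to null sets.\<close>

definition H2_derivatives :: "(real \<Rightarrow> real) \<Rightarrow> (real \<Rightarrow> real) \<Rightarrow> (real \<Rightarrow> real) \<Rightarrow> bool"
  where "H2_derivatives v v1 v2 \<longleftrightarrow>
    square_integrable_0_pi v \<and>
    (\<forall>x\<in>{0..pi}. (v has_real_derivative v1 x) (at x within {0..pi})) \<and>
    abs_continuous_on 0 pi v1 \<and>
    (AE x in lebesgue. x \<in> {0..pi} \<longrightarrow> (v1 has_real_derivative v2 x) (at x within {0..pi})) \<and>
    square_integrable_0_pi v2"

text \<open>\<open>v'' + lam v = g\<close> on \<open>(0,\<pi>)\<close>, \<open>v(0) = c\<close>, \<open>v(\<pi>) = d\<close>. For \<open>v \<in> H\<^sup>2\<close> the equation is an equality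
  of \<open>L\<^sup>2\<close> functions; for continuous \<open>g\<close> it is equivalent to the pointwise equation for a
  \<open>C\<^sup>2\<close> function, by \<open>bvp_solution_iff_classical\<close>.\<close>

definition bvp_solution :: "real \<Rightarrow> (real \<Rightarrow> real) \<Rightarrow> real \<Rightarrow> real \<Rightarrow> (real \<Rightarrow> real) \<Rightarrow> bool"
  where "bvp_solution lam g c d v \<longleftrightarrow>
    (\<exists>v1 v2. H2_derivatives v v1 v2 \<and>
       (AE x in lebesgue. x \<in> {0<..<pi} \<longrightarrow> v2 x + lam * v x = g x)) \<and>
    v 0 = c \<and> v pi = d"

subsection \<open>Agreement with classical solutions\<close>

lemma Lipschitz_imp_abs_continuous_on:
  assumes L: "\<And>x y. a \<le> x \<Longrightarrow> x \<le> y \<Longrightarrow> y \<le> b \<Longrightarrow> \<bar>f y - f x\<bar> \<le> L * (y - x)"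
  shows "abs_continuous_on a b f"
  unfolding abs_continuous_on_def
proof (intro allI impI)
  fix e :: real assume e: "0 < e"
  define M where "M = \<bar>L\<bar> + 1"
  have M: "M > 0" "L \<le> M" by (auto simp: M_def)
  show "\<exists>\<delta>>0. \<forall>d t. d division_of t \<and> t \<subseteq> {a..b} \<and> (\<Sum>K\<in>d. Sup K - Inf K) < \<delta>
      \<longrightarrow> (\<Sum>K\<in>d. \<bar>f (Sup K) - f (Inf K)\<bar>) < e"
  proof (intro exI[of _ "e / M"] conjI allI impI)
    show "0 < e / M" using e M by simp
    fix d t
    assume d: "d division_of t \<and> t \<subseteq> {a..b} \<and> (\<Sum>K\<in>d. Sup K - Inf K) < e / M"
    have "(\<Sum>K\<in>d. \<bar>f (Sup K) - f (Inf K)\<bar>) \<le> (\<Sum>K\<in>d. M * (Sup K - Inf K))"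
    proof (rule sum_mono)
      fix K assume K: "K \<in> d"
      then obtain p q where pq: "K = cbox p q" "K \<noteq> {}" "K \<subseteq> {a..b}"
        using d division_ofD[of d t] by (metis subset_trans)
      then have "p \<le> q" "a \<le> p" "q \<le> b" by (auto simp: box_real)
      then have "\<bar>f q - f p\<bar> \<le> L * (q - p)" "L * (q - p) \<le> M * (q - p)"
        using L M by (auto intro!: mult_right_mono)
      then show "\<bar>f (Sup K) - f (Inf K)\<bar> \<le> M * (Sup K - Inf K)"
        using pq \<open>p \<le> q\<close> by (simp add: box_real)
    qed
    also have "\<dots> = M * (\<Sum>K\<in>d. Sup K - Inf K)" by (simp add: sum_distrib_left)
    also have "\<dots> < e" using d M by (simp add: field_simps)
    finally show "(\<Sum>K\<in>d. \<bar>f (Sup K) - f (Inf K)\<bar>) < e" .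
  qed
qed

lemma C1_imp_abs_continuous_on:
  assumes "\<And>x. x \<in> {a..b} \<Longrightarrow> (f has_real_derivative f' x) (at x within {a..b})"
    and "continuous_on {a..b} f'"
  shows "abs_continuous_on a b f"
proof -
  obtain B where B: "\<And>x. x \<in> {a..b} \<Longrightarrow> \<bar>f' x\<bar> \<le> B"
    using compact_imp_bounded[OF compact_continuous_image[OF assms(2) compact_Icc]]
    unfolding bounded_iff by (metis imageI real_norm_def)
  show ?thesis
  proof (rule Lipschitz_imp_abs_continuous_on[of _ _ _ B])
    fix x y assume "a \<le> x" "x \<le> y" "y \<le> b"
    then show "\<bar>f y - f x\<bar> \<le> B * (y - x)"
      using field_differentiable_bound[of "{a..b}" f f' B y x] assms(1) B by auto
  qed
qed

lemma abs_continuous_on_diff: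
  assumes "abs_continuous_on a b f" "abs_continuous_on a b g"
  shows "abs_continuous_on a b (\<lambda>x. f x - g x)"
  unfolding abs_continuous_on_def
proof (intro allI impI)
  fix e :: real assume "0 < e"
  then have e: "e / 2 > 0" by simp
  obtain d1 where d1: "d1 > 0" "\<And>d t. d division_of t \<and> t \<subseteq> {a..b} \<and> (\<Sum>K\<in>d. Sup K - Inf K) < d1
      \<Longrightarrow> (\<Sum>K\<in>d. \<bar>f (Sup K) - f (Inf K)\<bar>) < e / 2"
    using assms(1) e unfolding abs_continuous_on_def by blast
  obtain d2 where d2: "d2 > 0" "\<And>d t. d division_of t \<and> t \<subseteq> {a..b} \<and> (\<Sum>K\<in>d. Sup K - Inf K) < d2
      \<Longrightarrow> (\<Sum>K\<in>d. \<bar>g (Sup K) - g (Inf K)\<bar>) < e / 2"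
    using assms(2) e unfolding abs_continuous_on_def by blast
  show "\<exists>\<delta>>0. \<forall>d t. d division_of t \<and> t \<subseteq> {a..b} \<and> (\<Sum>K\<in>d. Sup K - Inf K) < \<delta>
      \<longrightarrow> (\<Sum>K\<in>d. \<bar>f (Sup K) - g (Sup K) - (f (Inf K) - g (Inf K))\<bar>) < e"
  proof (intro exI[of _ "min d1 d2"] conjI allI impI)
    show "0 < min d1 d2" using d1 d2 by simp
    fix d t assume d: "d division_of t \<and> t \<subseteq> {a..b} \<and> (\<Sum>K\<in>d. Sup K - Inf K) < min d1 d2"
    have "(\<Sum>K\<in>d. \<bar>f (Sup K) - g (Sup K) - (f (Inf K) - g (Inf K))\<bar>)
        \<le> (\<Sum>K\<in>d. \<bar>f (Sup K) - f (Inf K)\<bar> + \<bar>g (Sup K) - g (Inf K)\<bar>)"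
      by (rule sum_mono) linarith
    also have "\<dots> < e"
      using d1(2)[of d t] d2(2)[of d t] d by (simp add: sum.distrib)
    finally show "(\<Sum>K\<in>d. \<bar>f (Sup K) - g (Sup K) - (f (Inf K) - g (Inf K))\<bar>) < e" .
  qed
qed

lemma abs_continuous_on_zero_deriv:
  assumes ac: "abs_continuous_on a b f" and N: "negligible N"
    and der: "\<And>x. x \<in> {a..b} - N \<Longrightarrow> (f has_real_derivative 0) (at x within {a..b})"
    and c: "c \<in> {a..b}"
  shows "f c = f a"
proof -
  have "\<bar>f c - f a\<bar> \<le> e * (1 + (c - a))" if e: "e > 0" for e :: real
  proof -
    obtain \<delta> where \<delta>: "\<delta> > 0" "\<And>d t. d division_of t \<and> t \<subseteq> {a..b} \<and> (\<Sum>K\<in>d. Sup K - Inf K) < \<delta>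
      \<Longrightarrow> (\<Sum>K\<in>d. \<bar>f (Sup K) - f (Inf K)\<bar>) < e"
      using ac e unfolding abs_continuous_on_def by blast
    have N0: "N \<in> null_sets lebesgue" using N negligible_iff_null_sets by blast
    then obtain U where U: "open U" "N \<subseteq> U" "U - N \<in> lmeasurable"
        "emeasure lebesgue (U - N) < ennreal \<delta>"
      using sets_lebesgue_outer_open[of N \<delta>] \<delta>(1) by auto
    have Um: "U \<in> sets lebesgue" using U(1) by auto
    have "emeasure lebesgue U = emeasure lebesgue (U - N)"
      using emeasure_Diff_null_set[OF N0 Um] by simp
    then have Ue: "emeasure lebesgue U < ennreal \<delta>" using U(4) by simp
    then have Ulm: "U \<in> lmeasurable"
      using Um by (auto simp: fmeasurable_def intro: less_trans)
    have Umeas: "measure lebesgue U < \<delta>"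
      using Ue \<delta>(1) Ulm by (simp add: emeasure_eq_measure2 ennreal_less_iff)
    have "\<exists>r>0. \<forall>y\<in>{a..b}. dist y x < r \<longrightarrow> \<bar>f y - f x\<bar> \<le> e * \<bar>y - x\<bar>"
      if "x \<in> {a..b} - N" for x
    proof -
      have "(f has_derivative (\<lambda>h. 0)) (at x within {a..b})"
        using der[OF that] by (simp add: has_field_derivative_def mult_zero_left[abs_def])
      then show ?thesis
        using e that unfolding has_derivative_within_alt by (auto simp: dist_real_def)
    qed
    then obtain r where r: "\<And>x. x \<in> {a..b} - N \<Longrightarrow> r x > 0 \<and>
        (\<forall>y\<in>{a..b}. dist y x < r x \<longrightarrow> \<bar>f y - f x\<bar> \<le> e * \<bar>y - x\<bar>)"
      by metis
    define \<gamma> where "\<gamma> x = (if x \<in> N then U else if x \<in> {a..b} then ball x (r x) else ball x 1)" for x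
    have "gauge \<gamma>"
      unfolding gauge_def \<gamma>_def using U r by auto
    then obtain p where p: "p tagged_division_of {a..c}" "\<gamma> fine p"
      using fine_division_exists_real by blast
    have pp: "p tagged_partial_division_of {a..c}" and fin: "finite p"
      using p(1) by (auto simp: tagged_division_of_def tagged_partial_division_of_def)
    have ends: "\<exists>u w. K = {u..w} \<and> u \<le> w \<and> x \<in> {u..w} \<and> a \<le> u \<and> w \<le> c \<and> Sup K = w \<and> Inf K = u"
      if "(x, K) \<in> p" for x K
    proof -
      have "x \<in> K" "K \<subseteq> {a..c}" "\<exists>u w. K = cbox u w"
        using tagged_partial_division_ofD(2,3,4)[OF pp, of x K] that by auto
      then obtain u w where "K = {u..w}" "x \<in> K" "K \<subseteq> {a..c}"
        by auto
      moreover from this have "u \<le> w" by auto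
      ultimately show ?thesis by (intro exI[of _ u] exI[of _ w]) auto
    qed
    define q where "q = {z \<in> p. fst z \<in> N}"
    have qp: "q \<subseteq> p" by (auto simp: q_def)
    have qq: "q tagged_partial_division_of {a..c}"
      using tagged_partial_division_subset[OF pp qp] .
    have dq: "snd ` q division_of \<Union>(snd ` q)"
      using partial_division_of_tagged_division[OF qq] .
    have "(\<Sum>K\<in>snd ` q. Sup K - Inf K) = (\<Sum>K\<in>snd ` q. measure lebesgue K)"
    proof (rule sum.cong[OF refl])
      fix K assume "K \<in> snd ` q"
      then obtain x where "(x, K) \<in> p" using qp by auto
      then obtain u w where "K = {u..w}" "u \<le> w" using ends by blast
      then show "Sup K - Inf K = measure lebesgue K" by simp
    qed
    also have "\<dots> = measure lebesgue (\<Union>(snd ` q))"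
      using content_division[OF dq] by simp
    also have "\<dots> \<le> measure lebesgue U"
    proof (rule measure_mono_fmeasurable)
      show "\<Union>(snd ` q) \<subseteq> U"
        using p(2) qp by (fastforce simp: q_def fine_def \<gamma>_def)
      show "\<Union>(snd ` q) \<in> sets lebesgue"
        using lmeasurable_division[OF dq] by auto
    qed (use Ulm in auto)
    finally have small: "(\<Sum>K\<in>snd ` q. Sup K - Inf K) < \<delta>" using Umeas by simp
    have "\<Union>(snd ` q) \<subseteq> {a..b}"
      using tagged_partial_division_ofD(3)[OF qq] c by fastforce
    then have s1: "(\<Sum>K\<in>snd ` q. \<bar>f (Sup K) - f (Inf K)\<bar>) < e"
      using \<delta>(2)[of "snd ` q" "\<Union>(snd ` q)"] dq small by blast
    have s2: "(\<Sum>(x,K)\<in>q. \<bar>f (Sup K) - f (Inf K)\<bar>) = (\<Sum>K\<in>snd ` q. \<bar>f (Sup K) - f (Inf K)\<bar>)"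
    proof -
      let ?F = "\<lambda>K. if K = {} then 0 else \<bar>f (Sup K) - f (Inf K)\<bar>"
      have ne: "K \<noteq> {}" if "(x, K) \<in> q" for x K
        using tagged_partial_division_ofD(2)[OF qq that] by auto
      have "q tagged_division_of \<Union>(snd ` q)"
        using tagged_partial_division_of_Union_self[OF qq] .
      then have "(\<Sum>(x,K)\<in>q. ?F K) = (\<Sum>K\<in>snd ` q. ?F K)"
        by (rule sum.over_tagged_division_lemma) (auto simp: box_real)
      moreover have "(\<Sum>(x,K)\<in>q. ?F K) = (\<Sum>(x,K)\<in>q. \<bar>f (Sup K) - f (Inf K)\<bar>)"
        using ne by (intro sum.cong) auto
      moreover have "(\<Sum>K\<in>snd ` q. ?F K) = (\<Sum>K\<in>snd ` q. \<bar>f (Sup K) - f (Inf K)\<bar>)"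
        using ne by (intro sum.cong) auto
      ultimately show ?thesis by simp
    qed
    have "(\<Sum>(x,K)\<in>p-q. \<bar>f (Sup K) - f (Inf K)\<bar>) \<le> (\<Sum>(x,K)\<in>p-q. e * (Sup K - Inf K))"
    proof (rule sum_mono, clarify)
      fix x K assume xK: "(x, K) \<in> p" "(x, K) \<notin> q"
      obtain u w where K: "K = {u..w}" "u \<le> w" "x \<in> {u..w}" "a \<le> u" "w \<le> c" "Sup K = w" "Inf K = u"
        using ends[OF xK(1)] by blast
      have xN: "x \<in> {a..b} - N" using xK K c by (auto simp: q_def)
      have "K \<subseteq> ball x (r x)" using fineD[OF p(2) xK(1)] xN by (simp add: \<gamma>_def)
      moreover have "u \<in> K" "w \<in> K" using K by auto
      ultimately have "dist u x < r x" "dist w x < r x" by (auto simp: dist_commute)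
      then have "\<bar>f u - f x\<bar> \<le> e * \<bar>u - x\<bar>" "\<bar>f w - f x\<bar> \<le> e * \<bar>w - x\<bar>"
        using r[OF xN] K c by auto
      moreover have "e * \<bar>u - x\<bar> + e * \<bar>w - x\<bar> = e * (w - u)"
        using K by (auto simp: algebra_simps)
      ultimately show "\<bar>f (Sup K) - f (Inf K)\<bar> \<le> e * (Sup K - Inf K)"
        unfolding K(6,7) by linarith
    qed
    also have "\<dots> \<le> (\<Sum>(x,K)\<in>p. e * (Sup K - Inf K))"
    proof (rule sum_mono2[OF fin])
      fix z assume "z \<in> p - (p - q)"
      then obtain x K where z: "z = (x, K)" "(x, K) \<in> p" by (cases z) auto
      then show "0 \<le> (case z of (x, K) \<Rightarrow> e * (Sup K - Inf K))" using ends[OF z(2)] e by auto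
    qed auto
    also have "\<dots> = e * (\<Sum>(x,K)\<in>p. Sup K - Inf K)"
      by (simp add: sum_distrib_left case_prod_beta)
    also have "\<dots> = e * (c - a)"
      using additive_tagged_division_1[of a c p "\<lambda>x. x"] p(1) c by simp
    finally have s3: "(\<Sum>(x,K)\<in>p-q. \<bar>f (Sup K) - f (Inf K)\<bar>) \<le> e * (c - a)" .
    have "\<bar>f c - f a\<bar> = \<bar>\<Sum>(x,K)\<in>p. f (Sup K) - f (Inf K)\<bar>"
      using additive_tagged_division_1[of a c p f] p(1) c by simp
    also have "\<dots> \<le> (\<Sum>(x,K)\<in>p. \<bar>f (Sup K) - f (Inf K)\<bar>)"
      by (rule order_trans[OF sum_abs]) (simp add: case_prod_beta)
    also have "\<dots> = (\<Sum>(x,K)\<in>p-q. \<bar>f (Sup K) - f (Inf K)\<bar>) + (\<Sum>(x,K)\<in>q. \<bar>f (Sup K) - f (Inf K)\<bar>)"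
      using sum.subset_diff[OF qp fin] by simp
    also have "\<dots> \<le> e * (1 + (c - a))"
      using s1 s2 s3 by (simp add: algebra_simps)
    finally show ?thesis .
  qed
  note * = this
  have pos: "1 + (c - a) > 0" using c by auto
  have "\<bar>f c - f a\<bar> \<le> 0"
  proof (rule field_le_epsilon)
    fix e :: real assume "0 < e"
    then show "\<bar>f c - f a\<bar> \<le> 0 + e"
      using *[of "e / (1 + (c - a))"] pos by simp
  qed
  then show ?thesis by simp
qed

lemma square_integrable_0_pi_continuous:
  assumes "continuous_on {0..pi} g"
  shows "square_integrable_0_pi g"
  unfolding square_integrable_0_pi_def
proof
  have "(\<lambda>x. indicator {0..pi} x *\<^sub>R g x) \<in> borel_measurable lborel"
    using borel_measurable_continuous_on_indicator[OF _ assms] by simp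
  then show "set_borel_measurable lebesgue {0..pi} g"
    unfolding set_borel_measurable_def by (rule measurable_completion)
  have "set_integrable lborel {0..pi} (\<lambda>x. (g x)\<^sup>2)"
    by (rule borel_integrable_atLeastAtMost') (intro continuous_intros assms)
  then show "set_integrable lebesgue {0..pi} (\<lambda>x. (g x)\<^sup>2)"
    unfolding set_integrable_def
    by (subst integrable_completion) (auto dest: borel_measurable_integrable)
qed

lemma bvp_solution_iff_classical:
  assumes g: "continuous_on {0..pi} v \<Longrightarrow> continuous_on {0..pi} g"
  shows "bvp_solution lam g c d v \<longleftrightarrow>
    (\<exists>v1 v2. (\<forall>x\<in>{0..pi}. (v has_real_derivative v1 x) (at x within {0..pi})) \<and>
       (\<forall>x\<in>{0..pi}. (v1 has_real_derivative v2 x) (at x within {0..pi})) \<and>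
       continuous_on {0..pi} v2 \<and>
       (\<forall>x\<in>{0<..<pi}. v2 x + lam * v x = g x)) \<and>
    v 0 = c \<and> v pi = d"
  unfolding bvp_solution_def
proof (intro conj_cong[OF _ refl] iffI)
  assume "\<exists>v1 v2. H2_derivatives v v1 v2 \<and>
       (AE x in lebesgue. x \<in> {0<..<pi} \<longrightarrow> v2 x + lam * v x = g x)"
  then obtain v1 v2 where v1: "\<And>x. x \<in> {0..pi} \<Longrightarrow> (v has_real_derivative v1 x) (at x within {0..pi})"
    and ac: "abs_continuous_on 0 pi v1"
    and v2: "AE x in lebesgue. x \<in> {0..pi} \<longrightarrow> (v1 has_real_derivative v2 x) (at x within {0..pi})"
    and eq: "AE x in lebesgue. x \<in> {0<..<pi} \<longrightarrow> v2 x + lam * v x = g x"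
    unfolding H2_derivatives_def by blast
  have vc: "continuous_on {0..pi} v"
    using v1 DERIV_continuous by (fastforce simp: continuous_on_eq_continuous_within)
  define k where "k x = g x - lam * v x" for x
  have kc: "continuous_on {0..pi} k"
    unfolding k_def by (intro continuous_intros g vc)
  define G where "G x = integral {0..x} k" for x
  have G: "(G has_real_derivative k x) (at x within {0..pi})" if "x \<in> {0..pi}" for x
    unfolding G_def by (rule integral_has_real_derivative[OF kc that])
  have "abs_continuous_on 0 pi (\<lambda>x. v1 x - G x)"
    by (rule abs_continuous_on_diff[OF ac C1_imp_abs_continuous_on[OF G kc]])
  moreover
  have "AE x in lebesgue. x \<notin> {0, pi}"
    by (rule AE_not_in) (simp add: negligible_iff_null_sets[symmetric])
  with v2 eq have "AE x in lebesgue. x \<in> {0..pi} \<longrightarrow>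
      ((\<lambda>x. v1 x - G x) has_real_derivative 0) (at x within {0..pi})"
  proof eventually_elim
    case (elim x)
    show ?case
    proof
      assume x: "x \<in> {0..pi}"
      then have "v2 x = k x" using elim by (auto simp: k_def)
      then show "((\<lambda>x. v1 x - G x) has_real_derivative 0) (at x within {0..pi})"
        using DERIV_diff[OF _ G[OF x], of v1 "v2 x"] elim x by auto
    qed
  qed
  then obtain N where "N \<in> null_sets lebesgue" and N: "{x. \<not> (x \<in> {0..pi} \<longrightarrow>
      ((\<lambda>x. v1 x - G x) has_real_derivative 0) (at x within {0..pi}))} \<subseteq> N"
    unfolding eventually_ae_filter by auto
  then have "negligible N" by (simp add: negligible_iff_null_sets)
  ultimately have const: "v1 x - G x = v1 0 - G 0" if "x \<in> {0..pi}" for x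
    by (rule abs_continuous_on_zero_deriv[OF _ _ _ that]) (use N in auto)
  have "(v1 has_real_derivative k x) (at x within {0..pi})" if x: "x \<in> {0..pi}" for x
  proof (rule has_field_derivative_transform_within[OF _ zero_less_one x])
    show "((\<lambda>y. G y + (v1 0 - G 0)) has_real_derivative k x) (at x within {0..pi})"
      using DERIV_add[OF G[OF x] DERIV_const[of "v1 0 - G 0"]] by simp
  qed (use const in \<open>auto simp: algebra_simps\<close>)
  then show "\<exists>v1 v2. (\<forall>x\<in>{0..pi}. (v has_real_derivative v1 x) (at x within {0..pi})) \<and>
       (\<forall>x\<in>{0..pi}. (v1 has_real_derivative v2 x) (at x within {0..pi})) \<and>
       continuous_on {0..pi} v2 \<and> (\<forall>x\<in>{0<..<pi}. v2 x + lam * v x = g x)"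
    using v1 kc by (intro exI[of _ v1] exI[of _ k]) (auto simp: k_def)
next
  assume "\<exists>v1 v2. (\<forall>x\<in>{0..pi}. (v has_real_derivative v1 x) (at x within {0..pi})) \<and>
       (\<forall>x\<in>{0..pi}. (v1 has_real_derivative v2 x) (at x within {0..pi})) \<and>
       continuous_on {0..pi} v2 \<and> (\<forall>x\<in>{0<..<pi}. v2 x + lam * v x = g x)"
  then obtain v1 v2 where v: "\<And>x. x \<in> {0..pi} \<Longrightarrow> (v has_real_derivative v1 x) (at x within {0..pi})"
    "\<And>x. x \<in> {0..pi} \<Longrightarrow> (v1 has_real_derivative v2 x) (at x within {0..pi})"
    "continuous_on {0..pi} v2" "\<And>x. x \<in> {0<..<pi} \<Longrightarrow> v2 x + lam * v x = g x"
    by blast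
  have "continuous_on {0..pi} v"
    using v(1) DERIV_continuous by (fastforce simp: continuous_on_eq_continuous_within)
  then have "H2_derivatives v v1 v2"
    unfolding H2_derivatives_def
    using v C1_imp_abs_continuous_on[OF v(2,3)] by (auto intro: square_integrable_0_pi_continuous)
  then show "\<exists>v1 v2. H2_derivatives v v1 v2 \<and>
       (AE x in lebesgue. x \<in> {0<..<pi} \<longrightarrow> v2 x + lam * v x = g x)"
    using v(4) by (intro exI[of _ v1] exI[of _ v2]) auto
qed

end

theory Submission
  imports Defs
begin

text \<open>
  The homogeneous problem \<open>v'' + n\<^sup>2 v = 0\<close> with zero boundary values has the kernel spanned by
  \<open>\<phi> = sin(n\<cdot>)\<close>, so the perturbed problem is resonant and is treated by Lyapunov-Schmidt reduction.
  Write \<open>u\<close> for the given solution and, for \<open>v \<in> C[0,\<pi>]\<close>, let \<open>T v\<close> be the function \<open>w\<close> with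
  \<open>w'' + n\<^sup>2 w = f(x, v(x))\<close>, \<open>w(0) = \<eta>\<^sub>1(v)\<close> and \<open>w'(0) = 0\<close>, which variation of constants gives
  explicitly. A function \<open>v = u + a \<phi> + \<epsilon> T v\<close> then solves the perturbed equation and satisfies the
  boundary condition at \<open>0\<close>. It satisfies the one at \<open>\<pi>\<close> as soon as \<open>(T v)(\<pi>) = \<eta>\<^sub>2(v)\<close>, and this is
  the scalar solvability condition \<open>G v = 0\<close>, where \<open>G v\<close> is
  \<open>n (\<eta>\<^sub>1(v) + (-1)\<^bsup>n+1\<^esup> \<eta>\<^sub>2(v))\<close> minus the integral of \<open>f(s, v(s)) sin(ns)\<close> over \<open>[0,\<pi>]\<close>.
  In these terms the hypotheses are \<open>G u = 0\<close> and \<open>L \<phi> \<noteq> 0\<close>, where \<open>L = G'(u)\<close>.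

  For small \<open>\<epsilon>\<close> the system \<open>v \<in> u + \<real> \<phi> + \<epsilon> T v\<close>, \<open>G v = 0\<close> is solved by one contraction on a ball
  of \<open>C[0,\<pi>]\<close> (\<open>bifurcation_by_contraction\<close>), namely
  \<open>F v = u + \<epsilon> E (T v) + ((L (v - u) - G v) / L \<phi>) \<phi>\<close> with \<open>E x = x - (L x / L \<phi>) \<phi>\<close>.
  The projection \<open>E\<close> has its range in the kernel of \<open>L\<close>, so applying \<open>L\<close> to a fixed point gives
  \<open>G v = 0\<close>. The map \<open>F\<close> is contracting because \<open>T\<close> is Lipschitz near \<open>u\<close> and is multiplied by \<open>\<epsilon>\<close>,
  while \<open>v \<mapsto> L (v - u) - G v\<close> has a Lipschitz constant that tends to \<open>0\<close> with the radius of the ball.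
  The latter is strict differentiability of \<open>G\<close> at \<open>u\<close>. For \<open>\<eta>\<^sub>1\<close> and \<open>\<eta>\<^sub>2\<close> it follows from continuous
  differentiability (\<open>C1_imp_has_strict_derivative\<close>), and for the integral from the uniform
  continuity of \<open>f\<^sub>2\<close> on compact sets (\<open>integral_superposition_has_strict_derivative\<close>).
\<close>

section \<open>Strict differentiability\<close>

text \<open>Strict differentiability is what a contraction argument uses: it compares any two points near
  \<open>u\<close>, where the ordinary derivative at \<open>u\<close> compares a point with \<open>u\<close> only.\<close>

definition has_strict_derivative ::
    "('a::real_normed_vector \<Rightarrow> 'b::real_normed_vector) \<Rightarrow> ('a \<Rightarrow> 'b) \<Rightarrow> 'a \<Rightarrow> bool"
  where "has_strict_derivative G L u \<longleftrightarrow> bounded_linear L \<and>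
    (\<forall>e>0. \<exists>r>0. \<forall>x\<in>cball u r. \<forall>y\<in>cball u r. norm (G x - G y - L (x - y)) \<le> e * norm (x - y))"

lemma has_strict_derivativeE:
  assumes "has_strict_derivative G L u" "e > 0"
  obtains r where "r > 0" "\<And>x y. x \<in> cball u r \<Longrightarrow> y \<in> cball u r \<Longrightarrow>
    norm (G x - G y - L (x - y)) \<le> e * norm (x - y)"
  using assms unfolding has_strict_derivative_def by metis

lemma has_strict_derivative_scaleR:
  assumes "has_strict_derivative G L u"
  shows "has_strict_derivative (\<lambda>x. c *\<^sub>R G x) (\<lambda>x. c *\<^sub>R L x) u"
  unfolding has_strict_derivative_def
proof (intro conjI allI impI)
  show "bounded_linear (\<lambda>x. c *\<^sub>R L x)"
    using assms unfolding has_strict_derivative_def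
    by (intro bounded_linear_intros) auto
  fix e :: real assume e: "e > 0"
  then have "e / (\<bar>c\<bar> + 1) > 0" by simp
  then obtain r where r: "r > 0" "\<And>x y. x \<in> cball u r \<Longrightarrow> y \<in> cball u r \<Longrightarrow>
    norm (G x - G y - L (x - y)) \<le> e / (\<bar>c\<bar> + 1) * norm (x - y)"
    using has_strict_derivativeE[OF assms] by metis
  show "\<exists>r>0. \<forall>x\<in>cball u r. \<forall>y\<in>cball u r.
      norm (c *\<^sub>R G x - c *\<^sub>R G y - c *\<^sub>R L (x - y)) \<le> e * norm (x - y)"
  proof (intro exI[of _ r] conjI ballI)
    fix x y assume xy: "x \<in> cball u r" "y \<in> cball u r"
    have "norm (c *\<^sub>R G x - c *\<^sub>R G y - c *\<^sub>R L (x - y)) = \<bar>c\<bar> * norm (G x - G y - L (x - y))"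
      by (simp flip: scaleR_diff_right)
    also have "\<dots> \<le> (\<bar>c\<bar> + 1) * (e / (\<bar>c\<bar> + 1) * norm (x - y))"
      using r(2)[OF xy] by (intro mult_mono) auto
    also have "\<dots> = e * norm (x - y)" by simp
    finally show "norm (c *\<^sub>R G x - c *\<^sub>R G y - c *\<^sub>R L (x - y)) \<le> e * norm (x - y)" .
  qed (use r in auto)
qed

lemma has_strict_derivative_add:
  assumes "has_strict_derivative G L u" "has_strict_derivative H M u"
  shows "has_strict_derivative (\<lambda>x. G x + H x) (\<lambda>x. L x + M x) u"
  unfolding has_strict_derivative_def
proof (intro conjI allI impI)
  show "bounded_linear (\<lambda>x. L x + M x)"
    using assms unfolding has_strict_derivative_def
    by (intro bounded_linear_intros) auto
  fix e :: real assume "e > 0"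
  then have e: "e / 2 > 0" by simp
  obtain r where r: "r > 0" "\<And>x y. x \<in> cball u r \<Longrightarrow> y \<in> cball u r \<Longrightarrow>
    norm (G x - G y - L (x - y)) \<le> e / 2 * norm (x - y)"
    using has_strict_derivativeE[OF assms(1) e] by metis
  obtain s where s: "s > 0" "\<And>x y. x \<in> cball u s \<Longrightarrow> y \<in> cball u s \<Longrightarrow>
    norm (H x - H y - M (x - y)) \<le> e / 2 * norm (x - y)"
    using has_strict_derivativeE[OF assms(2) e] by metis
  show "\<exists>r>0. \<forall>x\<in>cball u r. \<forall>y\<in>cball u r.
      norm (G x + H x - (G y + H y) - (L (x - y) + M (x - y))) \<le> e * norm (x - y)"
  proof (intro exI[of _ "min r s"] conjI ballI)
    fix x y assume xy: "x \<in> cball u (min r s)" "y \<in> cball u (min r s)"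
    have "norm (G x + H x - (G y + H y) - (L (x - y) + M (x - y)))
        = norm ((G x - G y - L (x - y)) + (H x - H y - M (x - y)))"
      by (simp add: algebra_simps)
    also have "\<dots> \<le> norm (G x - G y - L (x - y)) + norm (H x - H y - M (x - y))"
      by (rule norm_triangle_ineq)
    also have "\<dots> \<le> e / 2 * norm (x - y) + e / 2 * norm (x - y)"
      using xy by (intro add_mono r s) auto
    finally show "norm (G x + H x - (G y + H y) - (L (x - y) + M (x - y))) \<le> e * norm (x - y)"
      by simp
  qed (use r s in auto)
qed

text \<open>The mean value inequality for \<open>G - G' u\<close>, whose derivative is small near \<open>u\<close>.\<close>

lemma C1_imp_has_strict_derivative:
  fixes G :: "'a::real_normed_vector \<Rightarrow> 'b::real_normed_vector"
  assumes der: "\<And>x. (G has_derivative blinfun_apply (G' x)) (at x)"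
    and cont: "isCont G' u"
  shows "has_strict_derivative G (blinfun_apply (G' u)) u"
  unfolding has_strict_derivative_def
proof (intro conjI allI impI)
  show "bounded_linear (blinfun_apply (G' u))" by (rule blinfun.bounded_linear_right)
  fix e :: real assume e: "e > 0"
  then obtain d where d: "d > 0" "\<And>x. dist x u < d \<Longrightarrow> dist (G' x) (G' u) < e"
    using cont unfolding continuous_at_eps_delta by metis
  show "\<exists>r>0. \<forall>x\<in>cball u r. \<forall>y\<in>cball u r.
      norm (G x - G y - blinfun_apply (G' u) (x - y)) \<le> e * norm (x - y)"
  proof (intro exI[of _ "d / 2"] conjI ballI)
    fix x y assume xy: "x \<in> cball u (d / 2)" "y \<in> cball u (d / 2)"
    have "norm ((G x - G' u x) - (G y - G' u y)) \<le> e * norm (x - y)"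
    proof (rule differentiable_bound[OF convex_cball _ _ xy])
      fix z assume z: "z \<in> cball u (d / 2)"
      show "((\<lambda>z. G z - G' u z) has_derivative (blinfun_apply (G' z - G' u))) (at z within cball u (d / 2))"
        unfolding blinfun.diff_left
        by (intro has_derivative_diff has_derivative_at_withinI[OF der]
            bounded_linear_imp_has_derivative blinfun.bounded_linear_right)
      have "dist z u < d" using z d(1) by (auto simp: dist_commute)
      then show "onorm (blinfun_apply (G' z - G' u)) \<le> e"
        using d(2)[of z] by (simp add: dist_norm norm_blinfun.rep_eq)
    qed
    then show "norm (G x - G y - blinfun_apply (G' u) (x - y)) \<le> e * norm (x - y)"
      by (simp add: blinfun.diff_right algebra_simps)
  qed (use d in auto)
qed

lemma has_strict_derivative_imp_lipschitz:
  assumes "has_strict_derivative G L u"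
  obtains r K where "r > 0" "K \<ge> 0" "\<And>x y. x \<in> cball u r \<Longrightarrow> y \<in> cball u r \<Longrightarrow>
    norm (G x - G y) \<le> K * norm (x - y)"
proof -
  obtain r where r: "r > 0" "\<And>x y. x \<in> cball u r \<Longrightarrow> y \<in> cball u r \<Longrightarrow>
    norm (G x - G y - L (x - y)) \<le> 1 * norm (x - y)"
    using has_strict_derivativeE[OF assms zero_less_one] by metis
  obtain B where B: "B \<ge> 0" "\<And>x. norm (L x) \<le> norm x * B"
    using bounded_linear.nonneg_bounded assms unfolding has_strict_derivative_def by metis
  have "norm (G x - G y) \<le> (1 + B) * norm (x - y)" if "x \<in> cball u r" "y \<in> cball u r" for x y
    using r(2)[OF that] B(2)[of "x - y"] norm_triangle_sub[of "G x - G y" "L (x - y)"]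
    by (simp add: algebra_simps)
  with r(1) B(1) show ?thesis by (intro that[of r "1 + B"]) auto
qed

section \<open>Lyapunov-Schmidt reduction by a single contraction\<close>

text \<open>The free coefficient \<open>a\<close> of \<open>\<phi>\<close> is what makes the scalar equation \<open>G v = 0\<close> solvable: since
  \<open>L \<phi> \<noteq> 0\<close>, moving \<open>v\<close> along \<open>\<phi>\<close> changes \<open>G v\<close> to first order. A Newton step for \<open>G\<close> in this
  direction, always with the derivative at \<open>u\<close>, is built into the map \<open>F\<close> of the proof.\<close>

lemma bifurcation_by_contraction:
  fixes T :: "'a::{real_normed_vector, complete_space} \<Rightarrow> 'a" and G :: "'a \<Rightarrow> real"
  assumes G: "has_strict_derivative G L u" "G u = 0" "L \<phi> \<noteq> 0"
    and T: "R > 0" "K \<ge> 0" "\<And>x y. x \<in> cball u R \<Longrightarrow> y \<in> cball u R \<Longrightarrow>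
      norm (T x - T y) \<le> K * norm (x - y)"
  shows "\<exists>\<delta>>0. \<forall>\<epsilon>::real. \<bar>\<epsilon>\<bar> < \<delta> \<longrightarrow> (\<exists>v a. v = u + a *\<^sub>R \<phi> + \<epsilon> *\<^sub>R T v \<and> G v = 0)"
proof -
  define \<beta> where "\<beta> = L \<phi>"
  have \<beta>: "\<beta> \<noteq> 0" using G by (simp add: \<beta>_def)
  interpret L: bounded_linear L using G(1) by (simp add: has_strict_derivative_def)
  obtain B where B: "B \<ge> 0" "\<And>x. \<bar>L x\<bar> \<le> norm x * B"
    using L.nonneg_bounded by auto
  define E where "E x = x - (L x / \<beta>) *\<^sub>R \<phi>" for x
  have E_diff: "E x - E y = E (x - y)" for x y
    by (simp add: E_def L.diff diff_divide_distrib algebra_simps)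
  have LE: "L (E x) = 0" for x
    using \<beta> by (simp add: E_def L.diff L.scaleR \<beta>_def)
  define C where "C = 1 + B * norm \<phi> / \<bar>\<beta>\<bar>"
  have C: "C > 0" using B(1) by (simp add: C_def add_pos_nonneg)
  have E_bound: "norm (E x) \<le> C * norm x" for x
  proof -
    have "norm (E x) \<le> norm x + \<bar>L x\<bar> / \<bar>\<beta>\<bar> * norm \<phi>"
      unfolding E_def by (rule order_trans[OF norm_triangle_ineq4]) simp
    also have "\<dots> \<le> norm x + norm x * B / \<bar>\<beta>\<bar> * norm \<phi>"
      by (intro add_mono mult_right_mono divide_right_mono B) auto
    finally show ?thesis by (simp add: C_def algebra_simps)
  qed
  \<comment> \<open>Both \<open>e\<close> and the first bound in \<open>\<delta>\<close> are chosen to contribute at most \<open>1/4\<close> to the Lipschitz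
    constant of \<open>F\<close>; the second bound in \<open>\<delta>\<close> keeps \<open>F u\<close> within \<open>r / 2\<close> of \<open>u\<close>.\<close>
  define e where "e = \<bar>\<beta>\<bar> / (4 * (norm \<phi> + 1))"
  have e: "e > 0" using \<beta> by (simp add: e_def add_nonneg_pos)
  have e_small: "e / \<bar>\<beta>\<bar> * norm \<phi> \<le> 1 / 4"
  proof -
    have "e / \<bar>\<beta>\<bar> = 1 / (4 * (norm \<phi> + 1))" using \<beta> by (simp add: e_def)
    then show ?thesis by (simp add: divide_le_eq add_nonneg_pos)
  qed
  obtain r0 where r0: "r0 > 0" "\<And>x y. x \<in> cball u r0 \<Longrightarrow> y \<in> cball u r0 \<Longrightarrow>
      \<bar>G x - G y - L (x - y)\<bar> \<le> e * norm (x - y)"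
    using has_strict_derivativeE[OF G(1) e] by (metis real_norm_def)
  define r where "r = min r0 R"
  have r: "r > 0" "r \<le> r0" "r \<le> R" using r0 T by (auto simp: r_def)
  define \<delta> where "\<delta> = min (1 / (4 * (K * C + 1))) (r / (2 * (C * norm (T u) + 1)))"
  have pos: "K * C + 1 > 0" "C * norm (T u) + 1 > 0"
    using T C by (auto intro!: add_nonneg_pos)
  have \<delta>: "\<delta> > 0" using pos r by (simp add: \<delta>_def)
  have "\<exists>v a. v = u + a *\<^sub>R \<phi> + \<epsilon> *\<^sub>R T v \<and> G v = 0" if \<epsilon>: "\<bar>\<epsilon>\<bar> < \<delta>" for \<epsilon> :: real
  proof -
    have \<epsilon>1: "\<bar>\<epsilon>\<bar> * (K * C) \<le> 1 / 4"
    proof -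
      have "\<bar>\<epsilon>\<bar> * (K * C) \<le> \<bar>\<epsilon>\<bar> * (K * C + 1)" by (simp add: mult_left_mono)
      also have "\<dots> \<le> 1 / (4 * (K * C + 1)) * (K * C + 1)"
        using \<epsilon> pos by (intro mult_right_mono) (auto simp: \<delta>_def)
      also have "\<dots> = 1 / 4" using pos(1) by simp
      finally show ?thesis .
    qed
    have \<epsilon>2: "\<bar>\<epsilon>\<bar> * (C * norm (T u)) \<le> r / 2"
    proof -
      have "\<bar>\<epsilon>\<bar> * (C * norm (T u)) \<le> \<bar>\<epsilon>\<bar> * (C * norm (T u) + 1)" by (simp add: mult_left_mono)
      also have "\<dots> \<le> r / (2 * (C * norm (T u) + 1)) * (C * norm (T u) + 1)"
        using \<epsilon> pos by (intro mult_right_mono) (auto simp: \<delta>_def)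
      also have "\<dots> = r / 2" using pos(2) by (simp add: divide_eq_eq)
      finally show ?thesis .
    qed
    define F where "F v = u + \<epsilon> *\<^sub>R E (T v) + ((L (v - u) - G v) / \<beta>) *\<^sub>R \<phi>" for v
    have contr: "norm (F v - F w) \<le> 1 / 2 * norm (v - w)"
      if v: "v \<in> cball u r" and w: "w \<in> cball u r" for v w
    proof -
      have vR: "v \<in> cball u R" "w \<in> cball u R" "v \<in> cball u r0" "w \<in> cball u r0"
        using v w r by auto
      have "F v - F w = \<epsilon> *\<^sub>R (E (T v) - E (T w))
          + ((L (v - u) - G v) / \<beta> - (L (w - u) - G w) / \<beta>) *\<^sub>R \<phi>"
        by (simp add: F_def algebra_simps)
      also have "(L (v - u) - G v) / \<beta> - (L (w - u) - G w) / \<beta> = - (G v - G w - L (v - w)) / \<beta>"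
        by (simp add: L.diff flip: diff_divide_distrib)
      finally have "F v - F w = \<epsilon> *\<^sub>R E (T v - T w) + (- (G v - G w - L (v - w)) / \<beta>) *\<^sub>R \<phi>"
        by (simp only: E_diff)
      then have "norm (F v - F w) \<le> \<bar>\<epsilon>\<bar> * norm (E (T v - T w))
          + \<bar>G v - G w - L (v - w)\<bar> / \<bar>\<beta>\<bar> * norm \<phi>"
        by (metis norm_triangle_ineq norm_scaleR abs_divide abs_minus_cancel)
      also have "\<dots> \<le> \<bar>\<epsilon>\<bar> * (C * (K * norm (v - w))) + e * norm (v - w) / \<bar>\<beta>\<bar> * norm \<phi>"
        using C by (intro add_mono mult_left_mono mult_right_mono divide_right_mono r0 vR
            order_trans[OF E_bound] T) auto
      also have "\<dots> = (\<bar>\<epsilon>\<bar> * (K * C) + e / \<bar>\<beta>\<bar> * norm \<phi>) * norm (v - w)"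
        by (simp add: algebra_simps)
      also have "\<dots> \<le> 1 / 2 * norm (v - w)"
      proof (rule mult_right_mono)
        show "\<bar>\<epsilon>\<bar> * (K * C) + e / \<bar>\<beta>\<bar> * norm \<phi> \<le> 1 / 2" using \<epsilon>1 e_small by linarith
      qed simp
      finally show ?thesis .
    qed
    have Fu: "norm (F u - u) \<le> r / 2"
    proof -
      have "norm (F u - u) = \<bar>\<epsilon>\<bar> * norm (E (T u))"
        using G(2) by (simp add: F_def L.zero)
      also have "\<dots> \<le> \<bar>\<epsilon>\<bar> * (C * norm (T u))"
        by (intro mult_left_mono E_bound) auto
      finally show ?thesis using \<epsilon>2 by simp
    qed
    have maps: "F ` cball u r \<subseteq> cball u r"
    proof (rule image_subsetI)
      fix v assume v: "v \<in> cball u r"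
      have "norm (F v - F u) \<le> 1 / 2 * norm (v - u)" using contr[OF v, of u] r by simp
      also have "\<dots> \<le> r / 2" using v by (simp add: dist_norm norm_minus_commute)
      finally have "norm (F v - u) \<le> r"
        using Fu norm_triangle_ineq[of "F v - F u" "F u - u"] by simp
      then show "F v \<in> cball u r" by (simp add: dist_norm norm_minus_commute)
    qed
    have "\<exists>!v. v \<in> cball u r \<and> F v = v"
      using r(1) maps contr
      by (intro Banach_fix[of _ "1/2"]) (auto simp: complete_eq_closed dist_norm)
    then obtain v where v: "F v = v" by blast
    \<comment> \<open>\<open>L\<close> kills the \<open>E\<close>-part of \<open>F v\<close> and recovers the numerator of the \<open>\<phi>\<close>-part.\<close>
    have "L (v - u) = L (F v - u)" using v by simp
    also have "\<dots> = L (v - u) - G v"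
      using \<beta> by (simp add: F_def L.add L.scaleR LE flip: \<beta>_def)
    finally have Gv: "G v = 0" by simp
    have "v = u + ((L (v - u) - G v) / \<beta> - \<epsilon> * L (T v) / \<beta>) *\<^sub>R \<phi> + \<epsilon> *\<^sub>R T v"
      using v by (simp add: F_def E_def algebra_simps)
    with Gv show ?thesis by blast
  qed
  with \<delta> show ?thesis by blast
qed

section \<open>Nonlinear superposition\<close>

text \<open>The radius does not depend on \<open>s\<close>, because \<open>f2\<close> is uniformly continuous on a compact
  neighbourhood of the graph of \<open>w\<close>. The estimate is then the mean value inequality in the second
  variable.\<close>

lemma superposition_strict_derivative:
  fixes f f2 :: "real \<Rightarrow> real \<Rightarrow> real"
  assumes f2_deriv: "\<And>x v. (f x has_real_derivative f2 x v) (at v)"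
    and f2_cont: "continuous_on UNIV (\<lambda>(x, v). f2 x v)"
    and w: "continuous_on {a..b} w" and e: "e > 0"
  obtains r where "r > 0" "\<And>s p q. s \<in> {a..b} \<Longrightarrow> \<bar>p - w s\<bar> \<le> r \<Longrightarrow> \<bar>q - w s\<bar> \<le> r \<Longrightarrow>
    \<bar>f s p - f s q - f2 s (w s) * (p - q)\<bar> \<le> e * \<bar>p - q\<bar>"
proof -
  obtain M where M: "\<And>x. x \<in> {a..b} \<Longrightarrow> \<bar>w x\<bar> \<le> M"
    using compact_imp_bounded[OF compact_continuous_image[OF w compact_Icc]]
    unfolding bounded_iff by (metis imageI real_norm_def)
  have "uniformly_continuous_on ({a..b} \<times> {-(M+1)..M+1}) (\<lambda>(x, v). f2 x v)"
    by (intro compact_uniformly_continuous continuous_on_subset[OF f2_cont] compact_Times) auto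
  then obtain d where d: "d > 0" "\<And>z z'. z \<in> {a..b} \<times> {-(M+1)..M+1} \<Longrightarrow>
      z' \<in> {a..b} \<times> {-(M+1)..M+1} \<Longrightarrow> dist z' z < d \<Longrightarrow>
      dist (case z' of (x, v) \<Rightarrow> f2 x v) (case z of (x, v) \<Rightarrow> f2 x v) < e"
    using e unfolding uniformly_continuous_on_def by metis
  show thesis
  proof (rule that[of "min 1 (d / 2)"])
    show "0 < min 1 (d / 2)" using d by simp
    fix s p q
    assume s: "s \<in> {a..b}" and p: "\<bar>p - w s\<bar> \<le> min 1 (d / 2)" and q: "\<bar>q - w s\<bar> \<le> min 1 (d / 2)"
    let ?S = "{w s - min 1 (d / 2)..w s + min 1 (d / 2)}"
    have "norm ((f s p - f2 s (w s) * p) - (f s q - f2 s (w s) * q)) \<le> e * norm (p - q)"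
    proof (rule field_differentiable_bound[of ?S])
      fix z assume z: "z \<in> ?S"
      show "((\<lambda>z. f s z - f2 s (w s) * z) has_real_derivative (f2 s z - f2 s (w s))) (at z within ?S)"
        using DERIV_subset[OF f2_deriv[of s z] subset_UNIV]
        by (auto intro!: derivative_eq_intros)
      have "\<bar>z - w s\<bar> \<le> min 1 (d / 2)"
        using z unfolding atLeastAtMost_iff abs_le_iff by linarith
      then have "\<bar>z - w s\<bar> \<le> 1" "\<bar>z - w s\<bar> < d" using d(1) by linarith+
      then have "dist (f2 s z) (f2 s (w s)) < e"
        using d(2)[of "(s, w s)" "(s, z)"] M[OF s] s d(1)
        by (auto simp: dist_Pair_Pair dist_real_def abs_le_iff)
      then show "norm (f2 s z - f2 s (w s)) \<le> e" by (simp add: dist_norm)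
    next
      show "p \<in> ?S" "q \<in> ?S"
        using p q unfolding atLeastAtMost_iff abs_le_iff by linarith+
    qed simp
    then show "\<bar>f s p - f s q - f2 s (w s) * (p - q)\<bar> \<le> e * \<bar>p - q\<bar>"
      by (simp add: algebra_simps)
  qed
qed

lemma superposition_lipschitz:
  fixes f f2 :: "real \<Rightarrow> real \<Rightarrow> real"
  assumes f2_deriv: "\<And>x v. (f x has_real_derivative f2 x v) (at v)"
    and f2_cont: "continuous_on UNIV (\<lambda>(x, v). f2 x v)"
    and w: "continuous_on {a..b} w"
  obtains r K where "r > 0" "K \<ge> 0" "\<And>s p q. s \<in> {a..b} \<Longrightarrow> \<bar>p - w s\<bar> \<le> r \<Longrightarrow> \<bar>q - w s\<bar> \<le> r \<Longrightarrow>
    \<bar>f s p - f s q\<bar> \<le> K * \<bar>p - q\<bar>"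
proof -
  obtain r where r: "r > 0" "\<And>s p q. s \<in> {a..b} \<Longrightarrow> \<bar>p - w s\<bar> \<le> r \<Longrightarrow> \<bar>q - w s\<bar> \<le> r \<Longrightarrow>
    \<bar>f s p - f s q - f2 s (w s) * (p - q)\<bar> \<le> 1 * \<bar>p - q\<bar>"
    using superposition_strict_derivative[OF f2_deriv f2_cont w zero_less_one] by metis
  have f2w: "continuous_on {a..b} (\<lambda>s. f2 s (w s))"
    using continuous_on_compose2[OF f2_cont continuous_on_Pair[OF continuous_on_id w]] by simp
  then obtain M where M: "\<And>s. s \<in> {a..b} \<Longrightarrow> \<bar>f2 s (w s)\<bar> \<le> M"
    using compact_imp_bounded[OF compact_continuous_image[OF f2w compact_Icc]]
    unfolding bounded_iff by (metis imageI real_norm_def)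
  have "\<bar>f s p - f s q\<bar> \<le> (1 + \<bar>M\<bar>) * \<bar>p - q\<bar>"
    if s: "s \<in> {a..b}" and pq: "\<bar>p - w s\<bar> \<le> r" "\<bar>q - w s\<bar> \<le> r" for s p q
  proof -
    have "\<bar>f2 s (w s) * (p - q)\<bar> \<le> \<bar>M\<bar> * \<bar>p - q\<bar>"
      unfolding abs_mult using M[OF s] by (intro mult_right_mono) auto
    then show ?thesis using r(2)[OF s pq] by (simp add: algebra_simps)
  qed
  with r(1) show ?thesis by (intro that[of r "1 + \<bar>M\<bar>"]) auto
qed

section \<open>The space of continuous functions on the interval\<close>

text \<open>The metric of the real line induces the topology of the interval. As bounded continuous functions
  on a metric space, \<open>C[0,\<pi>]\<close> is an instance of \<^class>\<open>complete_space\<close>, which the fixed point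
  theorem requires.\<close>

instantiation interval_0_pi :: metric_space
begin

definition dist_interval_0_pi :: "interval_0_pi \<Rightarrow> interval_0_pi \<Rightarrow> real"
  where "dist_interval_0_pi x y = dist (point_of x) (point_of y)"

definition uniformity_interval_0_pi :: "(interval_0_pi \<times> interval_0_pi) filter"
  where "uniformity_interval_0_pi = (INF e\<in>{0<..}. principal {(x, y). dist x y < e})"

instance
proof
  show "uniformity = (INF e\<in>{0<..}. principal {(x, y :: interval_0_pi). dist x y < e})"
    by (rule uniformity_interval_0_pi_def)
  have ev: "eventually P uniformity \<longleftrightarrow> (\<exists>e>0. \<forall>x y. dist x y < e \<longrightarrow> P (x, y))"
    for P :: "interval_0_pi \<times> interval_0_pi \<Rightarrow> bool"
    unfolding uniformity_interval_0_pi_def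
    by (subst eventually_INF_base)
      (auto simp: eventually_principal subset_eq intro: bexI[of _ "min _ _"])
  fix U :: "interval_0_pi set"
  show "open U \<longleftrightarrow> (\<forall>x\<in>U. \<forall>\<^sub>F (x', y) in uniformity. x' = x \<longrightarrow> y \<in> U)"
  proof
    assume "open U"
    then obtain V where V: "open V" "U = point_of -` V"
      unfolding open_interval_0_pi_def by blast
    show "\<forall>x\<in>U. \<forall>\<^sub>F (x', y) in uniformity. x' = x \<longrightarrow> y \<in> U"
    proof
      fix x assume "x \<in> U"
      then obtain e where "e > 0" "\<And>y. dist y (point_of x) < e \<Longrightarrow> y \<in> V"
        using V unfolding open_dist by blast
      then show "\<forall>\<^sub>F (x', y) in uniformity. x' = x \<longrightarrow> y \<in> U"
        unfolding ev V(2)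
        by (intro exI[of _ e]) (auto simp: dist_interval_0_pi_def dist_commute)
    qed
  next
    assume "\<forall>x\<in>U. \<forall>\<^sub>F (x', y) in uniformity. x' = x \<longrightarrow> y \<in> U"
    then obtain e where e: "\<And>x. x \<in> U \<Longrightarrow> e x > 0 \<and> (\<forall>y. dist x y < e x \<longrightarrow> y \<in> U)"
      unfolding ev by (simp add: Ball_def) metis
    show "open U"
      unfolding open_interval_0_pi_def
    proof (intro exI[of _ "\<Union>x\<in>U. ball (point_of x) (e x)"] conjI)
      show "U = point_of -` (\<Union>x\<in>U. ball (point_of x) (e x))"
        using e by (fastforce simp: dist_interval_0_pi_def)
    qed auto
  qed
next
  fix x y z :: interval_0_pi
  show "dist x y = 0 \<longleftrightarrow> x = y" by (simp add: dist_interval_0_pi_def point_of_inject)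
  show "dist x y \<le> dist x z + dist y z"
    unfolding dist_interval_0_pi_def by (rule dist_triangle2)
qed

end

text \<open>The inverse of \<^const>\<open>to_C\<close>. Only its values on \<open>[0,\<pi>]\<close> are meaningful.\<close>

definition of_C :: "C_0_pi \<Rightarrow> real \<Rightarrow> real"
  where "of_C u x = apply_bcontfun u (Abs_interval_0_pi x)"

lemma of_C_to_C:
  assumes "continuous_on {0..pi} v" "x \<in> {0..pi}"
  shows "of_C (to_C v) x = v x"
  using assms by (simp add: of_C_def to_C_apply Abs_interval_0_pi_inverse)

lemma continuous_on_of_C: "continuous_on {0..pi} (of_C u)"
proof -
  obtain v where v: "continuous_on {0..pi} v" "to_C v = u" using to_C_surj by blast
  show ?thesis
    using v of_C_to_C[OF v(1)] by (subst continuous_on_cong[OF refl, of _ _ v]) auto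
qed

lemma of_C_diff: "of_C (u - v) x = of_C u x - of_C v x"
  and of_C_add: "of_C (u + v) x = of_C u x + of_C v x"
  and of_C_scaleR: "of_C (c *\<^sub>R u) x = c * of_C u x"
  by (simp_all add: of_C_def)

lemma abs_of_C_le_norm: "\<bar>of_C u x\<bar> \<le> norm u"
  unfolding of_C_def using norm_bounded[of u] by simp

lemma C_0_pi_eqI:
  assumes "\<And>x. x \<in> {0..pi} \<Longrightarrow> of_C u x = of_C v x"
  shows "u = v"
proof (rule bcontfun_eqI)
  fix s show "apply_bcontfun u s = apply_bcontfun v s"
    using assms[OF point_of[of s]] by (simp add: of_C_def point_of_inverse)
qed

lemma norm_C_0_pi_le:
  assumes "\<And>x. x \<in> {0..pi} \<Longrightarrow> \<bar>of_C u x\<bar> \<le> B"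
  shows "norm u \<le> B"
proof (rule norm_bound)
  fix s show "norm (apply_bcontfun u s) \<le> B"
    using assms[OF point_of[of s]] by (simp add: of_C_def point_of_inverse)
qed

lemma abs_of_C_diff_le:
  assumes "continuous_on {0..pi} w" "s \<in> {0..pi}" "z \<in> cball (to_C w) r"
  shows "\<bar>of_C z s - w s\<bar> \<le> r"
  using abs_of_C_le_norm[of "z - to_C w" s] assms of_C_to_C[OF assms(1,2)]
  by (simp add: of_C_diff dist_norm norm_minus_commute)

lemma continuous_on_superposition:
  fixes f :: "real \<Rightarrow> real \<Rightarrow> real"
  assumes "continuous_on UNIV (\<lambda>(x, v). f x v)"
  shows "continuous_on {0..pi} (\<lambda>s. f s (of_C v s))"
  using continuous_on_compose2[OF assms continuous_on_Pair[OF continuous_on_id continuous_on_of_C]]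
  by simp

lemma abs_integral_le:
  fixes g :: "real \<Rightarrow> real"
  assumes "continuous_on {0..b} g" "\<And>s. s \<in> {0..b} \<Longrightarrow> \<bar>g s\<bar> \<le> B" "b \<ge> 0"
  shows "\<bar>integral {0..b} g\<bar> \<le> b * B"
  using integral_bound[OF assms(3,1), of B] assms(2) by (simp add: mult.commute)

text \<open>The pointwise estimates for \<open>f\<close> hold with the same radius for all \<open>s\<close>, so they may be
  integrated; the supremum norm keeps \<open>v(s)\<close> within that radius of \<open>w(s)\<close>.\<close>

lemma integral_superposition_has_strict_derivative:
  fixes f f2 :: "real \<Rightarrow> real \<Rightarrow> real"
  assumes f_cont: "continuous_on UNIV (\<lambda>(x, v). f x v)"
    and f2_deriv: "\<And>x v. (f x has_real_derivative f2 x v) (at v)"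
    and f2_cont: "continuous_on UNIV (\<lambda>(x, v). f2 x v)"
    and w: "continuous_on {0..pi} w" and k: "continuous_on {0..pi} k"
  shows "has_strict_derivative (\<lambda>v. integral {0..pi} (\<lambda>s. f s (of_C v s) * k s))
    (\<lambda>z. integral {0..pi} (\<lambda>s. f2 s (w s) * of_C z s * k s)) (to_C w)"
  (is "has_strict_derivative ?G ?L ?u")
proof -
  obtain M0 where M0: "\<And>s. s \<in> {0..pi} \<Longrightarrow> \<bar>k s\<bar> \<le> M0"
    using compact_imp_bounded[OF compact_continuous_image[OF k compact_Icc]]
    unfolding bounded_iff by (metis imageI real_norm_def)
  define M where "M = \<bar>M0\<bar> + 1"
  have M: "M > 0" "\<And>s. s \<in> {0..pi} \<Longrightarrow> \<bar>k s\<bar> \<le> M" using M0 by (fastforce simp: M_def)+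
  note fw = continuous_on_superposition[OF f_cont]
  have f2w: "continuous_on {0..pi} (\<lambda>s. f2 s (w s))"
    using continuous_on_compose2[OF f2_cont continuous_on_Pair[OF continuous_on_id w]] by simp
  note cont = continuous_intros fw f2w k continuous_on_of_C
  note integ = integrable_continuous_interval
  obtain N0 where N0: "\<And>s. s \<in> {0..pi} \<Longrightarrow> \<bar>f2 s (w s)\<bar> \<le> N0"
    using compact_imp_bounded[OF compact_continuous_image[OF f2w compact_Icc]]
    unfolding bounded_iff by (metis imageI real_norm_def)
  have lin: "bounded_linear ?L"
  proof (rule bounded_linear_intro[where K = "pi * (\<bar>N0\<bar> * M)"])
    fix x y :: C_0_pi and c :: real
    have "?L (x + y) = integral {0..pi} (\<lambda>s. f2 s (w s) * of_C x s * k s + f2 s (w s) * of_C y s * k s)"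
      by (simp add: of_C_add algebra_simps)
    also have "\<dots> = ?L x + ?L y" by (intro integral_add integ cont)
    finally show "?L (x + y) = ?L x + ?L y" .
    have "?L (c *\<^sub>R x) = integral {0..pi} (\<lambda>s. c *\<^sub>R (f2 s (w s) * of_C x s * k s))"
      by (simp add: of_C_scaleR algebra_simps)
    then show "?L (c *\<^sub>R x) = c *\<^sub>R ?L x" by simp
    have "\<bar>?L x\<bar> \<le> pi * (\<bar>N0\<bar> * norm x * M)"
    proof (rule abs_integral_le)
      fix s assume s: "s \<in> {0..pi}"
      have "\<bar>f2 s (w s)\<bar> \<le> \<bar>N0\<bar>" using N0[OF s] by simp
      then show "\<bar>f2 s (w s) * of_C x s * k s\<bar> \<le> \<bar>N0\<bar> * norm x * M"
        unfolding abs_mult using M(1) M(2)[OF s]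
        by (intro mult_mono abs_of_C_le_norm) auto
    qed (auto intro!: cont)
    then show "norm (?L x) \<le> norm x * (pi * (\<bar>N0\<bar> * M))" by (simp add: mult_ac)
  qed
  show ?thesis unfolding has_strict_derivative_def
  proof (intro conjI allI impI)
    show "bounded_linear ?L" by (rule lin)
    fix e :: real assume e: "e > 0"
    then have "e / (pi * M) > 0" using M by simp
    then obtain r where r: "r > 0" "\<And>s p q. s \<in> {0..pi} \<Longrightarrow> \<bar>p - w s\<bar> \<le> r \<Longrightarrow> \<bar>q - w s\<bar> \<le> r \<Longrightarrow>
        \<bar>f s p - f s q - f2 s (w s) * (p - q)\<bar> \<le> e / (pi * M) * \<bar>p - q\<bar>"
      using superposition_strict_derivative[OF f2_deriv f2_cont w] by metis
    show "\<exists>r>0. \<forall>x\<in>cball ?u r. \<forall>y\<in>cball ?u r. norm (?G x - ?G y - ?L (x - y)) \<le> e * norm (x - y)"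
    proof (intro exI[of _ r] conjI ballI)
      fix x y assume xy: "x \<in> cball ?u r" "y \<in> cball ?u r"
      let ?g = "\<lambda>s. (f s (of_C x s) - f s (of_C y s) - f2 s (w s) * (of_C x s - of_C y s)) * k s"
      have "?G x - ?G y - ?L (x - y) = integral {0..pi} (\<lambda>s. f s (of_C x s) * k s - f s (of_C y s) * k s)
          - ?L (x - y)"
        by (subst integral_diff) (auto intro!: integ cont)
      also have "\<dots> = integral {0..pi} (\<lambda>s. f s (of_C x s) * k s - f s (of_C y s) * k s
          - f2 s (w s) * of_C (x - y) s * k s)"
        by (rule integral_diff[symmetric]) (intro integ cont)+
      also have "\<dots> = integral {0..pi} ?g"
        by (simp add: of_C_diff algebra_simps)
      finally have eq: "?G x - ?G y - ?L (x - y) = integral {0..pi} ?g" .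
      have "\<bar>integral {0..pi} ?g\<bar> \<le> pi * (e / (pi * M) * norm (x - y) * M)"
      proof (rule abs_integral_le)
        fix s assume s: "s \<in> {0..pi}"
        have "\<bar>f s (of_C x s) - f s (of_C y s) - f2 s (w s) * (of_C x s - of_C y s)\<bar>
            \<le> e / (pi * M) * \<bar>of_C x s - of_C y s\<bar>"
          by (intro r s abs_of_C_diff_le w xy)
        also have "\<dots> \<le> e / (pi * M) * norm (x - y)"
          using abs_of_C_le_norm[of "x - y" s] e M by (intro mult_left_mono) (auto simp: of_C_diff)
        finally show "\<bar>?g s\<bar> \<le> e / (pi * M) * norm (x - y) * M"
          unfolding abs_mult using M(1) M(2)[OF s] e by (intro mult_mono) auto
      qed (auto intro!: cont)
      also have "\<dots> = e * norm (x - y)" using M(1) by simp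
      finally show "norm (?G x - ?G y - ?L (x - y)) \<le> e * norm (x - y)" by (simp add: eq)
    qed (rule r)
  qed
qed

section \<open>Variation of constants\<close>

text \<open>The solution of \<open>y'' + m\<^sup>2 y = k\<close>, \<open>y(0) = y'(0) = 0\<close>, that is
  \<open>(1/m) \<integral>\<^sub>0\<^sup>x sin(m(x - s)) k(s) ds\<close>. The addition theorem has been used to take \<open>x\<close> out of the
  integrand, so that differentiating in \<open>x\<close> needs only the fundamental theorem of calculus.\<close>

definition oscillator_response :: "real \<Rightarrow> (real \<Rightarrow> real) \<Rightarrow> real \<Rightarrow> real"
  where "oscillator_response m k x =
    (sin (m * x) * integral {0..x} (\<lambda>s. cos (m * s) * k s)
      - cos (m * x) * integral {0..x} (\<lambda>s. sin (m * s) * k s)) / m"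

definition oscillator_response_deriv :: "real \<Rightarrow> (real \<Rightarrow> real) \<Rightarrow> real \<Rightarrow> real"
  where "oscillator_response_deriv m k x =
    cos (m * x) * integral {0..x} (\<lambda>s. cos (m * s) * k s)
      + sin (m * x) * integral {0..x} (\<lambda>s. sin (m * s) * k s)"

lemma oscillator_response_derivs:
  assumes k: "continuous_on {0..b} k" and m: "m \<noteq> 0" and x: "x \<in> {0..b}"
  shows "(oscillator_response m k has_real_derivative oscillator_response_deriv m k x)
      (at x within {0..b})"
    and "(oscillator_response_deriv m k has_real_derivative k x - m\<^sup>2 * oscillator_response m k x)
      (at x within {0..b})"
proof -
  have C: "((\<lambda>x. integral {0..x} (\<lambda>s. cos (m * s) * k s)) has_real_derivative cos (m * x) * k x)
      (at x within {0..b})"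
    by (rule integral_has_real_derivative[OF _ x]) (intro continuous_intros k)
  have S: "((\<lambda>x. integral {0..x} (\<lambda>s. sin (m * s) * k s)) has_real_derivative sin (m * x) * k x)
      (at x within {0..b})"
    by (rule integral_has_real_derivative[OF _ x]) (intro continuous_intros k)
  show "(oscillator_response m k has_real_derivative oscillator_response_deriv m k x)
      (at x within {0..b})"
    unfolding oscillator_response_def[abs_def] oscillator_response_deriv_def
    apply (rule DERIV_cong)
     apply (rule derivative_eq_intros C S refl m)+
    using m by (simp add: field_simps)
  have *: "cos (m * x) * (cos (m * x) * k x) + sin (m * x) * (sin (m * x) * k x) = k x"
    using sin_cos_squared_add[of "m * x"] by algebra
  show "(oscillator_response_deriv m k has_real_derivative k x - m\<^sup>2 * oscillator_response m k x)
      (at x within {0..b})"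
    unfolding oscillator_response_deriv_def[abs_def] oscillator_response_def
    apply (rule DERIV_cong)
     apply (rule derivative_eq_intros C S refl)+
    (* The last k x, on the right, is expanded by the Pythagorean identity. *)
    apply (subst (3) *[symmetric])
    using m by (simp add: field_simps power2_eq_square)
qed

lemma continuous_on_oscillator_response:
  assumes "continuous_on {0..b} k" "m \<noteq> 0"
  shows "continuous_on {0..b} (oscillator_response m k)"
  using oscillator_response_derivs(1)[OF assms] DERIV_continuous_on by blast

lemma oscillator_response_diff_le:
  assumes k: "continuous_on {0..b} k" and l: "continuous_on {0..b} l" and m: "m \<noteq> 0"
    and x: "x \<in> {0..b}" and B: "\<And>s. s \<in> {0..b} \<Longrightarrow> \<bar>k s - l s\<bar> \<le> B"
  shows "\<bar>oscillator_response m k x - oscillator_response m l x\<bar> \<le> 2 * b * B / \<bar>m\<bar>"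
proof -
  have kx: "continuous_on {0..x} k" "continuous_on {0..x} l"
    using k l x by (auto intro: continuous_on_subset)
  have B0: "B \<ge> 0" using B[OF x] by simp
  have bound: "\<bar>g (m * x) * integral {0..x} (\<lambda>s. g' (m * s) * (k s - l s))\<bar> \<le> b * B"
    if g: "\<And>x. \<bar>g x\<bar> \<le> 1" "\<And>x. \<bar>g' x\<bar> \<le> 1" "continuous_on UNIV g'" for g g' :: "real \<Rightarrow> real"
  proof -
    have "\<bar>integral {0..x} (\<lambda>s. g' (m * s) * (k s - l s))\<bar> \<le> x * (1 * B)"
    proof (rule abs_integral_le)
      show "continuous_on {0..x} (\<lambda>s. g' (m * s) * (k s - l s))"
        by (intro continuous_intros kx continuous_on_compose2[OF g(3)]) auto
      fix s assume "s \<in> {0..x}"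
      then show "\<bar>g' (m * s) * (k s - l s)\<bar> \<le> 1 * B"
        unfolding abs_mult using x by (intro mult_mono g B) auto
    qed (use x in auto)
    also have "\<dots> \<le> b * B" using x B0 by (simp add: mult_right_mono)
    finally have "\<bar>integral {0..x} (\<lambda>s. g' (m * s) * (k s - l s))\<bar> \<le> b * B" .
    then have "\<bar>g (m * x)\<bar> * \<bar>integral {0..x} (\<lambda>s. g' (m * s) * (k s - l s))\<bar> \<le> 1 * (b * B)"
      by (intro mult_mono g) auto
    then show ?thesis by (simp add: abs_mult)
  qed
  have split: "integral {0..x} (\<lambda>s. g (m * s) * (k s - l s))
      = integral {0..x} (\<lambda>s. g (m * s) * k s) - integral {0..x} (\<lambda>s. g (m * s) * l s)"
    if "continuous_on UNIV g" for g :: "real \<Rightarrow> real"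
    unfolding right_diff_distrib
    by (intro integral_diff integrable_continuous_interval continuous_intros kx
        continuous_on_compose2[OF that]) auto
  have "oscillator_response m k x - oscillator_response m l x =
      (sin (m * x) * integral {0..x} (\<lambda>s. cos (m * s) * (k s - l s))
        - cos (m * x) * integral {0..x} (\<lambda>s. sin (m * s) * (k s - l s))) / m"
    unfolding oscillator_response_def
    by (subst (1 2) split) (auto intro!: continuous_intros simp: algebra_simps diff_divide_distrib add_divide_distrib)
  also have "\<bar>\<dots>\<bar> \<le> (b * B + b * B) / \<bar>m\<bar>"
    unfolding abs_divide
    by (intro divide_right_mono order_trans[OF abs_triangle_ineq4] add_mono bound)
      (auto intro!: continuous_intros)
  finally show ?thesis by (simp add: mult_ac)
qed

lemma oscillator_response_0: "oscillator_response m k 0 = 0"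
  by (simp add: oscillator_response_def)

text \<open>As \<open>sin(n\<pi>) = 0\<close>, the value at \<open>\<pi>\<close> sees only the component of \<open>k\<close> along \<open>sin(n\<cdot>)\<close>. This is
  where the solvability condition of the resonant problem comes from.\<close>

lemma oscillator_response_pi:
  assumes "n \<ge> 1"
  shows "real n * oscillator_response (real n) k pi
    = (-1) ^ (n + 1) * integral {0..pi} (\<lambda>s. k s * sin (real n * s))"
proof -
  have "(\<lambda>s. k s * sin (real n * s)) = (\<lambda>s. sin (real n * s) * k s)"
    by (simp add: mult.commute)
  then show ?thesis using assms by (simp add: oscillator_response_def)
qed

lemma oscillator_response_superposition_lipschitz:
  fixes f f2 :: "real \<Rightarrow> real \<Rightarrow> real"
  assumes f_cont: "continuous_on UNIV (\<lambda>(x, v). f x v)"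
    and f2_deriv: "\<And>x v. (f x has_real_derivative f2 x v) (at v)"
    and f2_cont: "continuous_on UNIV (\<lambda>(x, v). f2 x v)"
    and w: "continuous_on {0..pi} w" and m: "m \<noteq> 0"
  obtains r K where "r > 0" "K \<ge> 0" "\<And>u v x. u \<in> cball (to_C w) r \<Longrightarrow> v \<in> cball (to_C w) r \<Longrightarrow>
    x \<in> {0..pi} \<Longrightarrow> \<bar>oscillator_response m (\<lambda>s. f s (of_C u s)) x
      - oscillator_response m (\<lambda>s. f s (of_C v s)) x\<bar> \<le> K * norm (u - v)"
proof -
  obtain r K where rK: "r > 0" "K \<ge> 0" "\<And>s p q. s \<in> {0..pi} \<Longrightarrow> \<bar>p - w s\<bar> \<le> r \<Longrightarrow>
    \<bar>q - w s\<bar> \<le> r \<Longrightarrow> \<bar>f s p - f s q\<bar> \<le> K * \<bar>p - q\<bar>"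
    using superposition_lipschitz[OF f2_deriv f2_cont w] by metis
  show thesis
  proof (rule that[of r "2 * pi * K / \<bar>m\<bar>"])
    fix u v x
    assume u: "u \<in> cball (to_C w) r" and v: "v \<in> cball (to_C w) r" and x: "x \<in> {0..pi}"
    have "\<bar>oscillator_response m (\<lambda>s. f s (of_C u s)) x
        - oscillator_response m (\<lambda>s. f s (of_C v s)) x\<bar> \<le> 2 * pi * (K * norm (u - v)) / \<bar>m\<bar>"
    proof (rule oscillator_response_diff_le[OF _ _ m x])
      fix s assume s: "s \<in> {0..pi}"
      have "\<bar>f s (of_C u s) - f s (of_C v s)\<bar> \<le> K * \<bar>of_C u s - of_C v s\<bar>"
        by (intro rK s abs_of_C_diff_le w u v)
      also have "\<dots> \<le> K * norm (u - v)"
        using abs_of_C_le_norm[of "u - v" s] rK(2) by (intro mult_left_mono) (auto simp: of_C_diff)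
      finally show "\<bar>f s (of_C u s) - f s (of_C v s)\<bar> \<le> K * norm (u - v)" .
    qed (intro continuous_on_superposition f_cont)+
    then show "\<bar>oscillator_response m (\<lambda>s. f s (of_C u s)) x
        - oscillator_response m (\<lambda>s. f s (of_C v s)) x\<bar> \<le> 2 * pi * K / \<bar>m\<bar> * norm (u - v)"
      by simp
  qed (use rK in auto)
qed

section \<open>The boundary value problem\<close>

theorem theorem3p3:
  fixes h :: "real \<Rightarrow> real"
    and f f2 :: "real \<Rightarrow> real \<Rightarrow> real"
    and h1 h2 lam :: real
    and \<eta>1 \<eta>2 :: "C_0_pi \<Rightarrow> real"
    and \<eta>1' \<eta>2' :: "C_0_pi \<Rightarrow> (C_0_pi \<Rightarrow>\<^sub>L real)"
    and n :: nat
    and ubar :: "real \<Rightarrow> real"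
  assumes h_cont: "continuous_on UNIV h"
    and f_cont: "continuous_on UNIV (\<lambda>(x, v). f x v)"
    and f2_deriv: "\<And>x v. (f x has_real_derivative f2 x v) (at v)"
    and f2_cont: "continuous_on UNIV (\<lambda>(x, v). f2 x v)"
    and \<eta>1_deriv: "\<And>u. (\<eta>1 has_derivative blinfun_apply (\<eta>1' u)) (at u)"
    and \<eta>1'_cont: "continuous_on UNIV \<eta>1'"
    and \<eta>2_deriv: "\<And>u. (\<eta>2 has_derivative blinfun_apply (\<eta>2' u)) (at u)"
    and \<eta>2'_cont: "continuous_on UNIV \<eta>2'"
    and n: "n \<ge> 1"
    and lam: "lam = (real n)\<^sup>2"
    and ubar: "bvp_solution lam h h1 h2 ubar"
    and orth: "real n * (\<eta>1 (to_C ubar) + (-1) ^ (n + 1) * \<eta>2 (to_C ubar))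
      = integral {0..pi} (\<lambda>s. f s (ubar s) * sin (real n * s))"
    and nondeg: "real n * (blinfun_apply (\<eta>1' (to_C ubar)) (to_C (\<lambda>s. sin (real n * s)))
        + (-1) ^ (n + 1) * blinfun_apply (\<eta>2' (to_C ubar)) (to_C (\<lambda>s. sin (real n * s))))
      \<noteq> integral {0..pi} (\<lambda>s. f2 s (ubar s) * (sin (real n * s))\<^sup>2)"
  shows "\<exists>\<delta>>0. \<forall>\<epsilon>::real. \<bar>\<epsilon>\<bar> < \<delta> \<longrightarrow>
    (\<exists>v. bvp_solution lam (\<lambda>x. h x + \<epsilon> * f x (v x))
           (h1 + \<epsilon> * \<eta>1 (to_C v)) (h2 + \<epsilon> * \<eta>2 (to_C v)) v)"
proof -
  let ?s = "\<lambda>s. sin (real n * s)"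
  define g where "g v s = f s (of_C v s)" for v s
  \<comment> \<open>\<open>G\<close> is written with \<open>*\<^sub>R\<close> and sums so that the rules for strict derivatives apply to it.\<close>
  define G where "G v = real n *\<^sub>R (\<eta>1 v + ((-1) ^ (n + 1)) *\<^sub>R \<eta>2 v)
    + (-1) *\<^sub>R integral {0..pi} (\<lambda>s. f s (of_C v s) * ?s s)" for v
  define L where "L z = real n *\<^sub>R (\<eta>1' (to_C ubar) z + ((-1) ^ (n + 1)) *\<^sub>R \<eta>2' (to_C ubar) z)
    + (-1) *\<^sub>R integral {0..pi} (\<lambda>s. f2 s (ubar s) * of_C z s * ?s s)" for z
  define T where "T v = to_C (\<lambda>x. \<eta>1 v * cos (real n * x) + oscillator_response (real n) (g v) x)" for v
  have n0: "real n \<noteq> 0" using n by simp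
  have s_cont: "continuous_on {0..pi} ?s" by (intro continuous_intros)
  have h_on: "continuous_on {0..pi} h" using h_cont continuous_on_subset by blast
  obtain u1 u2 where
    u1: "\<And>x. x \<in> {0..pi} \<Longrightarrow> (ubar has_real_derivative u1 x) (at x within {0..pi})" and
    u2: "\<And>x. x \<in> {0..pi} \<Longrightarrow> (u1 has_real_derivative u2 x) (at x within {0..pi})" and
    u2_cont: "continuous_on {0..pi} u2" and
    u_eq: "\<And>x. x \<in> {0<..<pi} \<Longrightarrow> u2 x + lam * ubar x = h x" and
    u_bc: "ubar 0 = h1" "ubar pi = h2"
    using ubar unfolding bvp_solution_iff_classical[OF h_on] by blast
  have u_cont: "continuous_on {0..pi} ubar" using u1 DERIV_continuous_on by blast
  have g_cont: "continuous_on {0..pi} (g v)" for v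
    unfolding g_def by (rule continuous_on_superposition[OF f_cont])
  have osc_cont: "continuous_on {0..pi} (oscillator_response (real n) (g v))" for v
    by (rule continuous_on_oscillator_response[OF g_cont n0])
  have T_cont: "continuous_on {0..pi}
      (\<lambda>x. \<eta>1 v * cos (real n * x) + oscillator_response (real n) (g v) x)" for v
    by (intro continuous_intros osc_cont)
  have T_apply: "of_C (T v) x = \<eta>1 v * cos (real n * x) + oscillator_response (real n) (g v) x"
    if "x \<in> {0..pi}" for v x
    unfolding T_def by (rule of_C_to_C[OF T_cont that])

  have \<eta>1_strict: "has_strict_derivative \<eta>1 (\<eta>1' (to_C ubar)) (to_C ubar)"
    using C1_imp_has_strict_derivative[OF \<eta>1_deriv] \<eta>1'_cont
    by (simp add: continuous_on_eq_continuous_at)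
  have \<eta>2_strict: "has_strict_derivative \<eta>2 (\<eta>2' (to_C ubar)) (to_C ubar)"
    using C1_imp_has_strict_derivative[OF \<eta>2_deriv] \<eta>2'_cont
    by (simp add: continuous_on_eq_continuous_at)
  have G_strict: "has_strict_derivative G L (to_C ubar)"
    unfolding G_def[abs_def] L_def[abs_def]
    by (intro has_strict_derivative_add has_strict_derivative_scaleR \<eta>1_strict \<eta>2_strict
        integral_superposition_has_strict_derivative f_cont f2_deriv f2_cont u_cont s_cont)
  have G_u: "G (to_C ubar) = 0"
  proof -
    have "integral {0..pi} (\<lambda>s. f s (of_C (to_C ubar) s) * ?s s) = integral {0..pi} (\<lambda>s. f s (ubar s) * ?s s)"
      by (rule integral_cong) (simp add: of_C_to_C[OF u_cont])
    then show ?thesis using orth by (simp add: G_def)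
  qed
  have L_s: "L (to_C ?s) \<noteq> 0"
  proof -
    have "integral {0..pi} (\<lambda>s. f2 s (ubar s) * of_C (to_C ?s) s * ?s s)
        = integral {0..pi} (\<lambda>s. f2 s (ubar s) * (?s s)\<^sup>2)"
      by (rule integral_cong) (simp add: of_C_to_C[OF s_cont] power2_eq_square)
    then show ?thesis using nondeg by (simp add: L_def)
  qed

  obtain r1 K1 where K1: "r1 > 0" "K1 \<ge> 0" "\<And>x y. x \<in> cball (to_C ubar) r1 \<Longrightarrow>
      y \<in> cball (to_C ubar) r1 \<Longrightarrow> norm (\<eta>1 x - \<eta>1 y) \<le> K1 * norm (x - y)"
    using has_strict_derivative_imp_lipschitz[OF \<eta>1_strict] by metis
  obtain r2 K2 where K2: "r2 > 0" "K2 \<ge> 0" "\<And>u v x. u \<in> cball (to_C ubar) r2 \<Longrightarrow>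
      v \<in> cball (to_C ubar) r2 \<Longrightarrow> x \<in> {0..pi} \<Longrightarrow>
      \<bar>oscillator_response (real n) (g u) x - oscillator_response (real n) (g v) x\<bar> \<le> K2 * norm (u - v)"
    using oscillator_response_superposition_lipschitz[OF f_cont f2_deriv f2_cont u_cont n0]
    unfolding g_def by metis
  have T_lipschitz: "norm (T u - T v) \<le> (K1 + K2) * norm (u - v)"
    if uv: "u \<in> cball (to_C ubar) (min r1 r2)" "v \<in> cball (to_C ubar) (min r1 r2)" for u v
  proof (rule norm_C_0_pi_le)
    fix x assume x: "x \<in> {0..pi}"
    have "\<bar>(\<eta>1 u - \<eta>1 v) * cos (real n * x)\<bar> \<le> K1 * norm (u - v) * 1"
      unfolding abs_mult using K1(2) K1(3)[of u v] uv by (intro mult_mono) auto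
    moreover have "\<bar>oscillator_response (real n) (g u) x - oscillator_response (real n) (g v) x\<bar>
        \<le> K2 * norm (u - v)"
      using uv x by (intro K2) auto
    ultimately show "\<bar>of_C (T u - T v) x\<bar> \<le> (K1 + K2) * norm (u - v)"
      by (simp add: of_C_diff T_apply[OF x] algebra_simps)
  qed

  have "\<exists>\<delta>>0. \<forall>\<epsilon>::real. \<bar>\<epsilon>\<bar> < \<delta> \<longrightarrow>
      (\<exists>v a. v = to_C ubar + a *\<^sub>R to_C ?s + \<epsilon> *\<^sub>R T v \<and> G v = 0)"
    by (rule bifurcation_by_contraction[OF G_strict G_u L_s, of "min r1 r2" "K1 + K2"])
      (use K1 K2 T_lipschitz in auto)
  moreover have "\<exists>v. bvp_solution lam (\<lambda>x. h x + \<epsilon> * f x (v x))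
      (h1 + \<epsilon> * \<eta>1 (to_C v)) (h2 + \<epsilon> * \<eta>2 (to_C v)) v"
    if v: "v = to_C ubar + a *\<^sub>R to_C ?s + \<epsilon> *\<^sub>R T v" and Gv: "G v = 0" for \<epsilon> a v
  proof -
    \<comment> \<open>\<open>v\<close> as a function on the reals, with its two derivatives in closed form.\<close>
    define V where "V x = ubar x + a * ?s x
      + \<epsilon> * (\<eta>1 v * cos (real n * x) + oscillator_response (real n) (g v) x)" for x
    define V1 where "V1 x = u1 x + a * (real n * cos (real n * x))
      + \<epsilon> * (- \<eta>1 v * real n * sin (real n * x) + oscillator_response_deriv (real n) (g v) x)" for x
    define V2 where "V2 x = u2 x - a * (lam * sin (real n * x))
      + \<epsilon> * (- \<eta>1 v * lam * cos (real n * x) + (g v x - lam * oscillator_response (real n) (g v) x))" for x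
    have V_cont: "continuous_on {0..pi} V"
      unfolding V_def by (intro continuous_intros u_cont osc_cont)
    have V: "V x = of_C v x" if x: "x \<in> {0..pi}" for x
      by (subst v) (simp add: V_def of_C_add of_C_scaleR T_apply[OF x]
          of_C_to_C[OF u_cont x] of_C_to_C[OF s_cont x])
    have to_C_V: "to_C V = v"
      by (rule C_0_pi_eqI) (simp add: of_C_to_C[OF V_cont] V)
    note osc = oscillator_response_derivs[OF g_cont n0]
    have d1: "(V has_real_derivative V1 x) (at x within {0..pi})" if x: "x \<in> {0..pi}" for x
      unfolding V_def[abs_def] V1_def
      apply (rule DERIV_cong)
       apply (rule derivative_eq_intros u1[OF x] osc(1)[OF x] refl)+
      by (simp add: algebra_simps)
    have d2: "(V1 has_real_derivative V2 x) (at x within {0..pi})" if x: "x \<in> {0..pi}" for x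
      unfolding V1_def[abs_def] V2_def
      apply (rule DERIV_cong)
       apply (rule derivative_eq_intros u2[OF x] osc(2)[OF x] refl)+
      by (simp add: lam power2_eq_square algebra_simps)
    have V2_cont: "continuous_on {0..pi} V2"
      unfolding V2_def by (intro continuous_intros u2_cont g_cont osc_cont)
    have eq: "V2 x + lam * V x = h x + \<epsilon> * f x (V x)" if x: "x \<in> {0<..<pi}" for x
    proof -
      have "g v x = f x (V x)" using V[of x] x by (simp add: g_def)
      then show ?thesis using u_eq[OF x] by (simp add: V_def V2_def algebra_simps)
    qed
    have bc0: "V 0 = h1 + \<epsilon> * \<eta>1 v"
      by (simp add: V_def u_bc oscillator_response_0)
    \<comment> \<open>The boundary condition at \<open>\<pi>\<close> amounts to \<open>(T v)(\<pi>) = \<eta>\<^sub>2(v)\<close>, which is \<open>G v = 0\<close>.\<close>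
    have "real n * (\<eta>1 v * (-1) ^ n + oscillator_response (real n) (g v) pi)
        = real n * (\<eta>1 v * (-1) ^ n) + (-1) ^ (n + 1) * integral {0..pi} (\<lambda>s. g v s * ?s s)"
      unfolding distrib_left oscillator_response_pi[OF n] ..
    also have "integral {0..pi} (\<lambda>s. g v s * ?s s) = real n * (\<eta>1 v + (-1) ^ (n + 1) * \<eta>2 v)"
      using Gv by (simp add: G_def g_def)
    also have "real n * (\<eta>1 v * (-1) ^ n) + (-1) ^ (n + 1) * (real n * (\<eta>1 v + (-1) ^ (n + 1) * \<eta>2 v))
        = real n * \<eta>2 v"
      by (cases "even n") (simp_all add: algebra_simps)
    finally have "\<eta>1 v * (-1) ^ n + oscillator_response (real n) (g v) pi = \<eta>2 v"
      using n0 by simp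
    then have bcpi: "V pi = h2 + \<epsilon> * \<eta>2 v"
      by (simp add: V_def u_bc)
    have rhs_cont: "continuous_on {0..pi} (\<lambda>x. h x + \<epsilon> * f x (V x))"
      using continuous_on_compose2[OF f_cont continuous_on_Pair[OF continuous_on_id V_cont]]
      by (intro continuous_intros h_on) simp
    have "bvp_solution lam (\<lambda>x. h x + \<epsilon> * f x (V x)) (h1 + \<epsilon> * \<eta>1 (to_C V)) (h2 + \<epsilon> * \<eta>2 (to_C V)) V"
      unfolding bvp_solution_iff_classical[OF rhs_cont] to_C_V
      using d1 d2 V2_cont eq bc0 bcpi by blast
    then show ?thesis by blast
  qed
  ultimately show ?thesis by meson
qed

end
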